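(* Let $K_0\in\mathfrak g$ and, for each $t$, let $b_-(t)\in\mathcal L$, $b_+(t)\in\mathcal K$ be the unique solution of the factorization problem $$\exp\left(-\tfrac12tK_0\right)=b_-(t)\circ b_+(t)^{-1}.$$ Then for all $t$, $$K(t)=b_\pm(t)^{-1}\circ K_0\circ b_\pm(t)$$ (the same operator for both choices of sign) solves the initial value problem $$\dot K=\tfrac12[\Pi_{\mathfrak l}K,K]=\tfrac12[K,\Pi_{\mathfrak k}K],\qquad K(0)=K_0.$$
   Context: Let $\mathcal H=L^2(\mathbb R)$ (real-valued functions) and let $\mathfrak g$ be the space of Hilbert-Schmidt operators on $\mathcal H$, i.e. integral operators with kernel in $L^2(\mathbb R^2)$, with bracket $[A,B]=A\circ B-B\circ A$. Let $I$ be the identity and $G=GL(\mathcal H)\cap(I+\mathfrak g)$, where $GL(\mathcal H)$ is the group of invertible bounded operators. Let $\mathfrak l\subset\mathfrak g$ be the set of Volterra operators $(A\varphi)(x)=\int_{-\infty}^xA(x,y)\varphi(y)\,dy$ (kernel vanishing for $y>x$), and $\mathfrak k=\{B\in\mathfrak g:B^*=-B\}$. One has $\mathfrak g=\mathfrak l\oplus\mathfrak k$; $\Pi_{\mathfrak l},\Pi_{\mathfrak k}$ are the associated projections onto $\mathfrak l$ and $\mathfrak k$. Put $\mathcal L=I+\mathfrak l$ and $\mathcal K=\{k\in G:k\circ k^*=k^*\circ k=I\}$, which are subgroups of $G$. Every element of $G$ factors uniquely as $b_-\circ b_+^{-1}$ with $b_-\in\mathcal L$, $b_+\in\mathcal K$.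 $\exp$ is the operator exponential $\exp(A)=\sum_{j\ge0}A^j/j!$. *)

theory Defs
  imports "HOL-Analysis.Analysis"
begin

section \<open>The real Hilbert space of square-integrable functions\<close>

definition sq_integrable :: "('a::euclidean_space \<Rightarrow> real) \<Rightarrow> bool" where
  "sq_integrable f \<longleftrightarrow> f \<in> borel_measurable lborel \<and> integrable lborel (\<lambda>x. (f x)\<^sup>2)"

definition L2_rel :: "('a::euclidean_space \<Rightarrow> real) \<Rightarrow> ('a \<Rightarrow> real) \<Rightarrow> bool" where
  "L2_rel f g \<longleftrightarrow> sq_integrable f \<and> sq_integrable g \<and> (AE x in lborel. f x = g x)"

lemma sq_integrable_mult:
  assumes "sq_integrable f" "sq_integrable g"
  shows "integrable lborel (\<lambda>x. f x * g x)"
proof (rule Bochner_Integration.integrable_bound)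
  show "integrable lborel (\<lambda>x. (f x)\<^sup>2 + (g x)\<^sup>2)"
    using assms by (auto simp: sq_integrable_def)
  show "(\<lambda>x. f x * g x) \<in> borel_measurable lborel"
    using assms by (auto simp: sq_integrable_def)
  have "norm (f x * g x) \<le> norm ((f x)\<^sup>2 + (g x)\<^sup>2)" for x
  proof -
    have "2 * (\<bar>f x\<bar> * \<bar>g x\<bar>) \<le> (f x)\<^sup>2 + (g x)\<^sup>2"
      using sum_squares_bound[of "\<bar>f x\<bar>" "\<bar>g x\<bar>"] by (simp add: mult.assoc)
    moreover have "0 \<le> \<bar>f x\<bar> * \<bar>g x\<bar>" by simp
    ultimately have "\<bar>f x\<bar> * \<bar>g x\<bar> \<le> (f x)\<^sup>2 + (g x)\<^sup>2" by linarith
    then show ?thesis by (simp add: abs_mult)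
  qed
  then show "AE x in lborel. norm (f x * g x) \<le> norm ((f x)\<^sup>2 + (g x)\<^sup>2)" by simp
qed

lemma sq_integrable_zero: "sq_integrable (\<lambda>x. 0)"
  by (simp add: sq_integrable_def)

lemma sq_integrable_add:
  assumes "sq_integrable f" "sq_integrable g"
  shows "sq_integrable (\<lambda>x. f x + g x)"
proof -
  have "integrable lborel (\<lambda>x. (f x)\<^sup>2 + (g x)\<^sup>2 + 2 * (f x * g x))"
    using assms sq_integrable_mult[OF assms] by (auto simp: sq_integrable_def)
  then show ?thesis
    using assms by (auto simp: sq_integrable_def power2_sum mult.assoc)
qed

lemma sq_integrable_scale: "sq_integrable f \<Longrightarrow> sq_integrable (\<lambda>x. c * f x)"
  by (auto simp: sq_integrable_def power_mult_distrib)

lemma sq_integrable_uminus: "sq_integrable f \<Longrightarrow> sq_integrable (\<lambda>x. - f x)"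
  using sq_integrable_scale[of f "-1"] by simp

lemma sq_integrable_diff:
  "sq_integrable f \<Longrightarrow> sq_integrable g \<Longrightarrow> sq_integrable (\<lambda>x. f x - g x)"
  using sq_integrable_add[OF _ sq_integrable_uminus, of f g] by simp

quotient_type (overloaded) 'a L2 = "'a::euclidean_space \<Rightarrow> real" / partial: L2_rel
proof (rule part_equivpI)
  show "\<exists>f::'a \<Rightarrow> real. L2_rel f f"
    using sq_integrable_zero by (auto simp: L2_rel_def)
  show "symp (L2_rel :: ('a \<Rightarrow> real) \<Rightarrow> _)"
    by (auto simp: L2_rel_def symp_def)
  show "transp (L2_rel :: ('a \<Rightarrow> real) \<Rightarrow> _)"
    by (auto simp: L2_rel_def transp_def)
qed

instantiation L2 :: (euclidean_space) real_inner
begin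

lift_definition zero_L2 :: "'a L2" is "\<lambda>x. 0"
  by (simp add: L2_rel_def sq_integrable_zero)

lift_definition plus_L2 :: "'a L2 \<Rightarrow> 'a L2 \<Rightarrow> 'a L2" is "\<lambda>f g x. f x + g x"
  by (auto simp: L2_rel_def sq_integrable_add)

lift_definition uminus_L2 :: "'a L2 \<Rightarrow> 'a L2" is "\<lambda>f x. - f x"
  by (auto simp: L2_rel_def sq_integrable_uminus)

lift_definition minus_L2 :: "'a L2 \<Rightarrow> 'a L2 \<Rightarrow> 'a L2" is "\<lambda>f g x. f x - g x"
  by (auto simp: L2_rel_def sq_integrable_diff)

lift_definition scaleR_L2 :: "real \<Rightarrow> 'a L2 \<Rightarrow> 'a L2" is "\<lambda>c f x. c * f x"
  by (auto simp: L2_rel_def sq_integrable_scale)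

lift_definition inner_L2 :: "'a L2 \<Rightarrow> 'a L2 \<Rightarrow> real" is "\<lambda>f g. LINT x|lborel. f x * g x"
  by (intro integral_cong_AE) (auto simp: L2_rel_def sq_integrable_def)

definition norm_L2 :: "'a L2 \<Rightarrow> real" where "norm_L2 f = sqrt (inner f f)"
definition dist_L2 :: "'a L2 \<Rightarrow> 'a L2 \<Rightarrow> real" where "dist_L2 f g = norm (f - g)"
definition sgn_L2 :: "'a L2 \<Rightarrow> 'a L2" where "sgn_L2 f = inverse (norm f) *\<^sub>R f"
definition uniformity_L2 :: "('a L2 \<times> 'a L2) filter" where
  "uniformity_L2 = (INF e\<in>{0<..}. principal {(f, g). dist f g < e})"
definition open_L2 :: "'a L2 set \<Rightarrow> bool" where
  "open_L2 U \<longleftrightarrow> (\<forall>f\<in>U. \<forall>\<^sub>F (f', g) in uniformity. f' = f \<longrightarrow> g \<in> U)"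

instance
proof
  fix a b :: real and f g h :: "'a L2"
  show "f + g + h = f + (g + h)"
    by transfer (auto simp: L2_rel_def sq_integrable_add add.assoc)
  show "f + g = g + f"
    by transfer (auto simp: L2_rel_def sq_integrable_add add.commute)
  show "0 + f = f" by transfer (auto simp: L2_rel_def)
  show "- f + f = 0" by transfer (auto simp: L2_rel_def sq_integrable_zero)
  show "f - g = f + - g" by transfer (auto simp: L2_rel_def sq_integrable_diff)
  show "a *\<^sub>R (f + g) = a *\<^sub>R f + a *\<^sub>R g"
    by transfer (auto simp: L2_rel_def sq_integrable_add sq_integrable_scale algebra_simps)
  show "(a + b) *\<^sub>R f = a *\<^sub>R f + b *\<^sub>R f"
    by transfer (auto simp: L2_rel_def sq_integrable_add sq_integrable_scale distrib_right)
  show "a *\<^sub>R b *\<^sub>R f = (a * b) *\<^sub>R f"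
    by transfer (auto simp: L2_rel_def sq_integrable_scale mult.assoc)
  show "1 *\<^sub>R f = f" by transfer (auto simp: L2_rel_def)
  show "dist f g = norm (f - g)" by (rule dist_L2_def)
  show "sgn f = inverse (norm f) *\<^sub>R f" by (rule sgn_L2_def)
  show "uniformity = (INF e\<in>{0<..}. principal {(f, g :: 'a L2). dist f g < e})"
    by (rule uniformity_L2_def)
  show "open U = (\<forall>f\<in>U. \<forall>\<^sub>F (f', g) in uniformity. f' = f \<longrightarrow> g \<in> U)" for U :: "'a L2 set"
    by (rule open_L2_def)
  show "f \<bullet> g = g \<bullet> f" by transfer (simp add: mult.commute)
  show "(f + g) \<bullet> h = f \<bullet> h + g \<bullet> h"
    by transfer (simp add: L2_rel_def distrib_right sq_integrable_mult)
  show "a *\<^sub>R f \<bullet> g = a * (f \<bullet> g)"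
    by transfer (simp add: mult.assoc)
  show "0 \<le> f \<bullet> f" by transfer simp
  show "f \<bullet> f = 0 \<longleftrightarrow> f = 0"
  proof (transfer, goal_cases)
    case (1 f)
    then have f: "sq_integrable f" by (simp add: L2_rel_def)
    then have "(LINT x|lborel. f x * f x) = 0 \<longleftrightarrow> (AE x in lborel. f x * f x = 0)"
      by (intro integral_nonneg_eq_0_iff_AE sq_integrable_mult) auto
    also have "\<dots> \<longleftrightarrow> L2_rel f (\<lambda>x. 0)"
      using f by (simp add: L2_rel_def sq_integrable_zero)
    finally show ?case .
  qed
  show "norm f = sqrt (f \<bullet> f)" by (rule norm_L2_def)
qed

end

lemma sq_integrable_rep: "sq_integrable (rep_L2 f)"
  using Quotient3_rep_reflp[OF Quotient3_L2] by (auto simp: L2_rel_def)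

lemma abs_rep_L2: "abs_L2 (rep_L2 f) = f"
  by (rule Quotient3_abs_rep[OF Quotient3_L2])

lemma norm_abs_L2_diff:
  assumes "sq_integrable f" "sq_integrable g"
  shows "(norm (abs_L2 f - abs_L2 g))\<^sup>2 = (LINT x|lborel. (f x - g x)\<^sup>2)"
proof -
  have "abs_L2 f - abs_L2 g = abs_L2 (\<lambda>x. f x - g x)"
    using assms by (simp add: minus_L2.abs_eq L2_rel_def)
  moreover have "inner (abs_L2 (\<lambda>x. f x - g x)) (abs_L2 (\<lambda>x. f x - g x))
      = (LINT x|lborel. (f x - g x)\<^sup>2)"
    using assms by (simp add: inner_L2.abs_eq L2_rel_def sq_integrable_diff power2_eq_square)
  ultimately show ?thesis by (simp add: power2_norm_eq_inner)
qed

instance L2 :: (euclidean_space) complete_space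
proof
  fix X :: "nat \<Rightarrow> 'a L2"
  assume X: "Cauchy X"
  have "\<exists>r. \<forall>n. strict_mono r \<and> (\<forall>m\<ge>r n. dist (X m) (X (r n)) < (1/4)^n)"
  proof -
    have "\<exists>r. \<forall>n. (\<forall>m\<ge>r n. \<forall>k\<ge>r n. dist (X m) (X k) < (1/4)^n) \<and> r n < r (Suc n)"
    proof (rule dependent_nat_choice)
      show "\<exists>N. \<forall>m\<ge>N. \<forall>k\<ge>N. dist (X m) (X k) < (1/4)^0"
        using X unfolding Cauchy_def by (metis power_0 zero_less_one)
      fix N n
      obtain M where "\<forall>m\<ge>M. \<forall>k\<ge>M. dist (X m) (X k) < (1/4)^Suc n"
        using X unfolding Cauchy_def
        by (metis zero_less_divide_1_iff zero_less_numeral zero_less_power)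
      then show "\<exists>M. (\<forall>m\<ge>M. \<forall>k\<ge>M. dist (X m) (X k) < (1/4)^Suc n) \<and> N < M"
        by (intro exI[of _ "max M (Suc N)"]) auto
    qed
    then show ?thesis by (metis order.refl strict_mono_Suc_iff)
  qed
  then obtain r where r: "strict_mono r"
    and rd: "\<And>n m. m \<ge> r n \<Longrightarrow> dist (X m) (X (r n)) < (1/4)^n" by blast
  define f where "f n = rep_L2 (X (r n))" for n
  have f: "sq_integrable (f n)" for n by (simp add: f_def sq_integrable_rep)
  have fm [measurable]: "f n \<in> borel_measurable lborel" for n
    using f by (simp add: sq_integrable_def)
  have int: "integrable lborel (\<lambda>x. (f m x - f n x)\<^sup>2)" for m n
    using sq_integrable_diff[OF f f, of m n] by (simp add: sq_integrable_def)
  have bound: "(\<integral>\<^sup>+x. ennreal ((f m x - f n x)\<^sup>2) \<partial>lborel) \<le> ennreal (((1/4)^n)\<^sup>2)"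
    if "n \<le> m" for m n
  proof -
    have "norm (X (r m) - X (r n)) \<le> (1/4)^n"
      using rd[of n "r m"] r that by (simp add: dist_norm strict_mono_less_eq less_imp_le)
    then have "(norm (X (r m) - X (r n)))\<^sup>2 \<le> ((1/4)^n)\<^sup>2" by (intro power_mono) auto
    moreover have "(norm (X (r m) - X (r n)))\<^sup>2 = (LINT x|lborel. (f m x - f n x)\<^sup>2)"
      using norm_abs_L2_diff[OF f f, of m n] by (simp add: f_def abs_rep_L2)
    ultimately have "(LINT x|lborel. (f m x - f n x)\<^sup>2) \<le> ((1/4)^n)\<^sup>2" by simp
    then show ?thesis
      by (subst nn_integral_eq_integral[OF int]) (auto intro: ennreal_leI)
  qed
  define u where "u n x = 2^n * (f (Suc n) x - f n x)\<^sup>2" for n x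
  have um [measurable]: "u n \<in> borel_measurable lborel" for n unfolding u_def by measurable
  have "(\<integral>\<^sup>+x. (\<Sum>n. ennreal (u n x)) \<partial>lborel) = (\<Sum>n. \<integral>\<^sup>+x. ennreal (u n x) \<partial>lborel)"
    by (rule nn_integral_suminf) measurable
  also have "\<dots> \<le> (\<Sum>n. ennreal ((1/2)^n))"
  proof (rule suminf_le)
    fix n
    have "(\<integral>\<^sup>+x. ennreal (u n x) \<partial>lborel)
        = ennreal (2^n) * (\<integral>\<^sup>+x. ennreal ((f (Suc n) x - f n x)\<^sup>2) \<partial>lborel)"
      by (simp add: u_def ennreal_mult nn_integral_cmult)
    also have "\<dots> \<le> ennreal (2^n) * ennreal (((1/4)^n)\<^sup>2)"
      by (intro mult_left_mono bound) auto
    also have "\<dots> = ennreal (2^n * ((1/4)^n)\<^sup>2)" by (simp add: ennreal_mult)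
    also have "2^n * ((1/4)^n)\<^sup>2 = ((1/8)^n :: real)"
      by (simp add: power2_eq_square flip: power_mult_distrib)
    also have "ennreal ((1/8)^n) \<le> ennreal ((1/2)^n)" by (intro ennreal_leI power_mono) auto
    finally show "(\<integral>\<^sup>+x. ennreal (u n x) \<partial>lborel) \<le> ennreal ((1/2)^n)" .
  qed auto
  also have "\<dots> = ennreal (\<Sum>n. (1/2)^n)" by (rule suminf_ennreal2) auto
  also have "\<dots> < \<infinity>" by simp
  finally have fin: "(\<integral>\<^sup>+x. (\<Sum>n. ennreal (u n x)) \<partial>lborel) \<noteq> \<infinity>" by simp
  have "AE x in lborel. (\<Sum>n. ennreal (u n x)) \<noteq> \<infinity>"
    by (rule nn_integral_PInf_AE[OF _ fin]) measurable
  then have conv: "AE x in lborel. convergent (\<lambda>n. f n x)"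
  proof eventually_elim
    case (elim x)
    have "summable (\<lambda>n. u n x)"
      using elim by (intro summable_suminf_not_top) (auto simp: u_def)
    then have s: "summable (\<lambda>n. (1/2)^n + u n x)"
      by (intro summable_add summable_geometric) auto
    have "norm (f (Suc n) x - f n x) \<le> (1/2)^n + u n x" for n
    proof -
      define d where "d = \<bar>f (Suc n) x - f n x\<bar>"
      have "0 \<le> 2^n * (d - (1/2)^n)\<^sup>2" by simp
      also have "\<dots> = 2^n * d\<^sup>2 + (2^n * (1/2)^n) * (1/2)^n - 2 * (2^n * (1/2)^n) * d"
        by (simp add: power2_eq_square algebra_simps)
      also have "2^n * (1/2)^n = (1::real)" by (simp flip: power_mult_distrib)
      finally have "2 * d \<le> (1/2)^n + 2^n * d\<^sup>2" by simp
      moreover have "0 \<le> d" by (simp add: d_def)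
      ultimately have "d \<le> (1/2)^n + 2^n * d\<^sup>2" by linarith
      then show ?thesis by (simp add: d_def u_def)
    qed
    then have "summable (\<lambda>n. f (Suc n) x - f n x)"
      by (intro summable_comparison_test'[OF s])
    then have "convergent (\<lambda>n. \<Sum>i<n. f (Suc i) x - f i x)"
      by (simp add: summable_iff_convergent)
    then have "convergent (\<lambda>n. f 0 x + (\<Sum>i<n. f (Suc i) x - f i x))"
      by (intro convergent_add convergent_const)
    then show ?case by (simp add: sum_lessThan_telescope[of "\<lambda>i. f i x"])
  qed
  define F where "F x = lim (\<lambda>n. f n x)" for x
  have Fm [measurable]: "F \<in> borel_measurable lborel" unfolding F_def by measurable
  have lim: "AE x in lborel. (\<lambda>n. f n x) \<longlonglongrightarrow> F x"
    using conv by eventually_elim (simp add: F_def convergent_LIMSEQ_iff)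
  have Fb: "(\<integral>\<^sup>+x. ennreal ((F x - f n x)\<^sup>2) \<partial>lborel) \<le> ennreal (((1/4)^n)\<^sup>2)" for n
  proof -
    have "(\<integral>\<^sup>+x. ennreal ((F x - f n x)\<^sup>2) \<partial>lborel)
        = (\<integral>\<^sup>+x. liminf (\<lambda>m. ennreal ((f m x - f n x)\<^sup>2)) \<partial>lborel)"
    proof (rule nn_integral_cong_AE, use lim in eventually_elim)
      case (elim x)
      have "(\<lambda>m. ennreal ((f m x - f n x)\<^sup>2)) \<longlonglongrightarrow> ennreal ((F x - f n x)\<^sup>2)"
        by (intro tendsto_ennrealI tendsto_intros elim)
      from lim_imp_Liminf[OF _ this] show ?case by simp
    qed
    also have "\<dots> \<le> liminf (\<lambda>m. \<integral>\<^sup>+x. ennreal ((f m x - f n x)\<^sup>2) \<partial>lborel)"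
      by (rule nn_integral_liminf) measurable
    also have "\<dots> \<le> liminf (\<lambda>m::nat. ennreal (((1/4)^n)\<^sup>2))"
      by (rule Liminf_mono) (use bound in \<open>auto simp: eventually_sequentially\<close>)
    also have "\<dots> = ennreal (((1/4)^n)\<^sup>2)" by (simp add: Liminf_const)
    finally show ?thesis .
  qed
  have Fd: "sq_integrable (\<lambda>x. F x - f n x)" for n
    unfolding sq_integrable_def
  proof (intro conjI integrableI_bounded)
    have "(\<integral>\<^sup>+x. ennreal (norm ((F x - f n x)\<^sup>2)) \<partial>lborel) \<le> ennreal (((1/4)^n)\<^sup>2)"
      using Fb[of n] by simp
    also have "\<dots> < \<infinity>" by simp
    finally show "(\<integral>\<^sup>+x. ennreal (norm ((F x - f n x)\<^sup>2)) \<partial>lborel) < \<infinity>" .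
  qed measurable
  have F: "sq_integrable F" using sq_integrable_add[OF Fd f, of 0 0] by simp
  have dF: "norm (X (r n) - abs_L2 F) \<le> (1/4)^n" for n
  proof -
    have "(norm (abs_L2 F - abs_L2 (f n)))\<^sup>2 = (LINT x|lborel. (F x - f n x)\<^sup>2)"
      by (rule norm_abs_L2_diff[OF F f])
    also have "ennreal \<dots> \<le> ennreal (((1/4)^n)\<^sup>2)"
      using Fb[of n] Fd[of n] by (subst (asm) nn_integral_eq_integral) (auto simp: sq_integrable_def)
    then have "(LINT x|lborel. (F x - f n x)\<^sup>2) \<le> ((1/4)^n)\<^sup>2" by (simp add: ennreal_le_iff)
    finally have "norm (abs_L2 F - abs_L2 (f n)) \<le> (1/4)^n"
      by (rule power2_le_imp_le) auto
    then show ?thesis by (simp add: f_def abs_rep_L2 norm_minus_commute)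
  qed
  have "(\<lambda>n. X (r n) - abs_L2 F) \<longlonglongrightarrow> 0"
  proof (rule Lim_null_comparison)
    show "\<forall>\<^sub>F n in sequentially. norm (X (r n) - abs_L2 F) \<le> (1/4)^n" using dF by simp
    show "(\<lambda>n. (1/4)^n :: real) \<longlonglongrightarrow> 0" by (rule LIMSEQ_power_zero) simp
  qed
  then have "(X \<circ> r) \<longlonglongrightarrow> abs_L2 F" by (simp add: LIM_zero_iff comp_def)
  with X r show "convergent X"
    by (metis Cauchy_converges_subseq convergent_def)
qed

instance L2 :: (euclidean_space) banach ..

section \<open>Operators on \<open>L\<^sup>2(\<real>)\<close>\<close>

type_synonym operator = "real L2 \<Rightarrow>\<^sub>L real L2"

definition invertible_op :: "operator \<Rightarrow> bool" where
  "invertible_op A \<longleftrightarrow> (\<exists>B. A o\<^sub>L B = id_blinfun \<and> B o\<^sub>L A = id_blinfun)"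

definition inv_op :: "operator \<Rightarrow> operator" where
  "inv_op A = (THE B. A o\<^sub>L B = id_blinfun \<and> B o\<^sub>L A = id_blinfun)"

definition adj_op :: "operator \<Rightarrow> operator" where
  "adj_op A = Blinfun (adjoint (blinfun_apply A))"

definition exp_op :: "operator \<Rightarrow> operator" where
  "exp_op A = (\<Sum>j. (((o\<^sub>L) A ^^ j) id_blinfun) /\<^sub>R fact j)"

definition bracket :: "operator \<Rightarrow> operator \<Rightarrow> operator" where
  "bracket A B = (A o\<^sub>L B) - (B o\<^sub>L A)"

text \<open>The integral kernel is an element of \<open>L\<^sup>2(\<real>\<^sup>2)\<close>. By Fubini the condition below does
  not depend on the representatives picked by \<^const>\<open>rep_L2\<close>, and for almost every \<open>x\<close> the
  integrand is Lebesgue integrable in \<open>y\<close>.\<close>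

definition has_kernel :: "operator \<Rightarrow> (real \<times> real) L2 \<Rightarrow> bool" where
  "has_kernel A k \<longleftrightarrow>
    (\<forall>\<phi>. AE x in lborel. rep_L2 (A \<phi>) x = (LINT y|lborel. rep_L2 k (x, y) * rep_L2 \<phi> y))"

definition \<gg> :: "operator set" where
  "\<gg> = {A. \<exists>k. has_kernel A k}"

definition kernel :: "operator \<Rightarrow> (real \<times> real) L2" where
  "kernel A = (THE k. has_kernel A k)"

definition \<ll> :: "operator set" where
  "\<ll> = {A. \<exists>k. has_kernel A k \<and> (AE (x, y) in lborel. y > x \<longrightarrow> rep_L2 k (x, y) = 0)}"

definition \<kk> :: "operator set" where
  "\<kk> = {B \<in> \<gg>. adj_op B = - B}"

text \<open>The projections belonging to the direct sum decomposition of \<open>\<gg>\<close> into \<open>\<ll>\<close> and \<open>\<kk>\<close>;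
  the values outside \<open>\<gg>\<close> are irrelevant.\<close>

definition proj_\<ll> :: "operator \<Rightarrow> operator" where
  "proj_\<ll> A = (THE L. L \<in> \<ll> \<and> A - L \<in> \<kk>)"

definition proj_\<kk> :: "operator \<Rightarrow> operator" where
  "proj_\<kk> A = (THE B. B \<in> \<kk> \<and> A - B \<in> \<ll>)"

definition group_G :: "operator set" where
  "group_G = {T. invertible_op T \<and> T - id_blinfun \<in> \<gg>}"

definition group_L :: "operator set" where
  "group_L = {id_blinfun + A | A. A \<in> \<ll>}"

definition group_K :: "operator set" where
  "group_K = {k \<in> group_G. k o\<^sub>L adj_op k = id_blinfun \<and> adj_op k o\<^sub>L k = id_blinfun}"

text \<open>Differentiability of a curve in \<open>\<gg>\<close> with respect to the Hilbert-Schmidt norm, which is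
  the \<open>L\<^sup>2(\<real>\<^sup>2)\<close> norm of the kernel.\<close>

definition has_\<gg>_derivative :: "(real \<Rightarrow> operator) \<Rightarrow> operator \<Rightarrow> real \<Rightarrow> bool" where
  "has_\<gg>_derivative K D t \<longleftrightarrow>
    (\<forall>s. K s \<in> \<gg>) \<and> D \<in> \<gg> \<and> ((\<lambda>s. kernel (K s)) has_vector_derivative kernel D) (at t)"

end

theory Submission
  imports Defs "HOL-Probability.Distribution_Functions"
begin

text \<open>
  Write \<open>u(t) = exp(-t K\<^sub>0 / 2)\<close>. Since \<open>b\<^sub>- = u b\<^sub>+\<close> and \<open>u\<close> commutes with \<open>K\<^sub>0\<close>, both
  conjugations of \<open>K\<^sub>0\<close> agree. The substance of the theorem is that the factors depend
  differentiably on \<open>t\<close> in the Hilbert-Schmidt norm, because nothing but their existence is given.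

  Fix \<open>t\<close> and put \<open>1 + a(s) = b\<^sub>-(t)\<^sup>-\<^sup>1 b\<^sub>-(s)\<close> and \<open>1 + b(s) = b\<^sub>-(s)\<^sup>-\<^sup>1 b\<^sub>-(t)\<close>, its inverse. The
  orthogonal factors cancel in \<open>(1 + a)(1 + a)\<^sup>* = 1 + S\<close>, where
  \<open>S(s) = b\<^sub>+(t)\<^sup>-\<^sup>1 u(s-t) u(s-t)\<^sup>* b\<^sub>+(t) - 1\<close> is explicit, differentiable, and zero at \<open>s = t\<close>.
  Multiplication by \<open>1 + b\<close> gives \<open>a\<^sup>* = b + S + b S\<close>. Let \<open>P\<close> truncate a kernel to the triangle
  \<open>y \<le> x\<close>. If \<open>a\<close> and \<open>b\<close> are both Volterra kernels, then \<open>P a\<^sup>* = 0\<close> and \<open>P b = b\<close>, so that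
  \<open>b = - P S - P (b S)\<close>. As \<open>P\<close> is a contraction for the Hilbert-Schmidt norm, this equation
  bounds \<open>b\<close> by \<open>2 \<parallel>S\<parallel>\<close> near \<open>t\<close> and makes \<open>b\<close> differentiable with derivative \<open>- P S'\<close>
  (\<open>Tri_equation_derivative\<close>). Then \<open>a\<^sup>* = b + S + b S\<close> and \<open>K(s) = (1 + b) K(t) (1 + a)\<close> are
  differentiable as well, and \<open>S' = - (K + K\<^sup>*) / 2\<close> together with \<open>\<Pi>\<^sub>\<ll> K = P (K + K\<^sup>*)\<close> yields the
  differential equation (\<open>factorization_flow_derivative\<close>).

  The argument rests on the inverse of \<open>1 + a\<close>, for a Volterra kernel \<open>a\<close>, again being \<open>1\<close> plus a
  Volterra kernel (\<open>Volterra_inverse\<close>). The part \<open>e\<close> of the inverse above the diagonal solves a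
  Volterra equation whose rows satisfy \<open>\<parallel>e(x,\<cdot>)\<parallel>\<^sup>2 \<le> \<alpha>(x) \<integral>\<^bsub>y\<le>x\<^esub> \<parallel>e(y,\<cdot>)\<parallel>\<^sup>2 dy\<close> with \<open>\<alpha>\<close> integrable, and an
  inequality of Gronwall type forces \<open>e = 0\<close>. The same fact gives \<open>b\<^sub>-(0) = 1\<close>, because the
  inverse of the orthogonal lower triangular \<open>b\<^sub>-(0)\<close> is both lower and upper triangular.

  All calculations take place in the algebra \<open>\<real> \<oplus> L\<^sup>2(\<real>\<^sup>2)\<close>, the unitization of the algebra of
  kernels, which is a unital Banach algebra for the norm \<open>\<bar>r\<bar> + \<parallel>k\<parallel>\<close>. Its exponential converges in
  the Hilbert-Schmidt norm and is mapped to the operator exponential by \<open>to_op\<close>.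
\<close>

section \<open>Square-integrable functions of two variables\<close>

lemma sq_integrable_dominated:
  assumes "h \<in> borel_measurable lborel" "integrable lborel g" "AE x in lborel. (h x)\<^sup>2 \<le> g x"
  shows "sq_integrable h" "(LINT x|lborel. (h x)\<^sup>2) \<le> (LINT x|lborel. g x)"
proof -
  have "integrable lborel (\<lambda>x. (h x)\<^sup>2)"
    by (rule Bochner_Integration.integrable_bound[OF assms(2)]) (use assms in auto)
  with assms show "sq_integrable h" "(LINT x|lborel. (h x)\<^sup>2) \<le> (LINT x|lborel. g x)"
    by (auto simp: sq_integrable_def intro!: integral_mono_AE)
qed

text \<open>The inequality in the inner product space \<open>L\<^sup>2\<close>, restated for representatives so that it can be
  applied to single rows and columns of a kernel.\<close>

lemma Cauchy_Schwarz_sq_integrable: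
  assumes "sq_integrable f" "sq_integrable g"
  shows "(LINT x|lborel. f x * g x)\<^sup>2 \<le> (LINT x|lborel. (f x)\<^sup>2) * (LINT x|lborel. (g x)\<^sup>2)"
  using Cauchy_Schwarz_ineq[of "abs_L2 f" "abs_L2 g"] assms
  by (simp add: inner_L2.abs_eq L2_rel_def power2_eq_square)

lemma AE_lborel_fst:
  fixes P :: "real \<Rightarrow> bool"
  assumes "AE x in lborel. P x"
  shows "AE p in (lborel :: (real \<times> real) measure). P (fst p)"
proof -
  from assms obtain N where N: "N \<in> null_sets lborel" "{x. \<not> P x} \<subseteq> N"
    by (auto simp: eventually_ae_filter)
  have "N \<times> UNIV \<in> null_sets (lborel \<Otimes>\<^sub>M (lborel :: real measure))"
    using N(1) by (intro lborel.times_in_null_sets1) simp_all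
  then show ?thesis
    using N(2) by (intro AE_I'[of "N \<times> UNIV"]) (auto simp: lborel_prod)
qed

lemma AE_lborel_snd:
  fixes P :: "real \<Rightarrow> bool"
  assumes "AE x in lborel. P x"
  shows "AE p in (lborel :: (real \<times> real) measure). P (snd p)"
proof -
  from assms obtain N where N: "N \<in> null_sets lborel" "{x. \<not> P x} \<subseteq> N"
    by (auto simp: eventually_ae_filter)
  have "UNIV \<times> N \<in> null_sets ((lborel :: real measure) \<Otimes>\<^sub>M lborel)"
    using N(1) by (intro lborel.times_in_null_sets2) simp_all
  then show ?thesis
    using N(2) by (intro AE_I'[of "UNIV \<times> N"]) (auto simp: lborel_prod)
qed

lemma AE_lborel_sections:
  fixes P :: "real \<times> real \<Rightarrow> bool"
  assumes "AE p in lborel. P p"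
  shows "AE x in lborel. AE y in lborel. P (x, y)"
  by (rule lborel_pair.AE_pair) (use assms in \<open>unfold lborel_prod\<close>)

lemma AE_lborel_swap:
  fixes P :: "real \<times> real \<Rightarrow> bool"
  assumes "AE p in lborel. P p"
  shows "AE p in lborel. P (snd p, fst p)"
proof -
  have *: "AE p in distr (lborel \<Otimes>\<^sub>M lborel) (lborel \<Otimes>\<^sub>M lborel) (\<lambda>(x, y). (y, x)). P p"
    using assms lborel_pair.distr_pair_swap unfolding lborel_prod by metis
  show ?thesis
    using AE_distrD[OF measurable_pair_swap' *] unfolding lborel_prod case_prod_unfold .
qed

lemma AE_lborel_sections':
  fixes P :: "real \<times> real \<Rightarrow> bool"
  assumes "AE p in lborel. P p"
  shows "AE y in lborel. AE x in lborel. P (x, y)"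
  using AE_lborel_sections[OF AE_lborel_swap[OF assms]] by simp

lemma AE_off_diagonal: "AE p in (lborel :: (real \<times> real) measure). fst p \<noteq> snd p"
proof -
  have "AE y in lborel. x \<noteq> y" for x :: real
    using AE_lborel_singleton[of x] by (simp add: eq_commute)
  then have "AE p in (lborel \<Otimes>\<^sub>M lborel). fst p \<noteq> (snd p :: real)"
  proof (intro lborel_pair.AE_pair_measure)
    have "open {p::real \<times> real. fst p \<noteq> snd p}"
      by (intro open_Collect_neq continuous_intros)
    then show "{p \<in> space (lborel \<Otimes>\<^sub>M lborel). fst p \<noteq> (snd p :: real)} \<in> sets (lborel \<Otimes>\<^sub>M lborel)"
      unfolding lborel_prod by simp
  qed simp
  then show ?thesis unfolding lborel_prod .
qed

lemma integral_lborel_fst: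
  fixes f :: "real \<times> real \<Rightarrow> real"
  assumes "integrable lborel f"
  shows "AE x in lborel. integrable lborel (\<lambda>y. f (x, y))"
    and "integrable lborel (\<lambda>x. LINT y|lborel. f (x, y))"
    and "(LINT x|lborel. LINT y|lborel. f (x, y)) = integral\<^sup>L lborel f"
  using lborel_pair.AE_integrable_fst'[of f] lborel_pair.integrable_fst'[of f]
    lborel_pair.integral_fst'[of f] assms
  by (simp_all add: lborel_prod)

lemma integral_lborel_swap:
  fixes f :: "real \<times> real \<Rightarrow> real"
  assumes "f \<in> borel_measurable lborel"
  shows "integral\<^sup>L lborel (\<lambda>p. f (snd p, fst p)) = integral\<^sup>L lborel f"
    and "integrable lborel (\<lambda>p. f (snd p, fst p)) \<longleftrightarrow> integrable lborel f"
  using lborel_pair.integral_product_swap[of f] lborel_pair.integrable_product_swap_iff[of f] assms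
  by (simp_all add: lborel_prod case_prod_unfold)

definition tensor :: "(real \<Rightarrow> real) \<Rightarrow> (real \<Rightarrow> real) \<Rightarrow> real \<times> real \<Rightarrow> real" where
  "tensor f g p = f (fst p) * g (snd p)"

lemma integrable_tensor:
  assumes f: "integrable lborel f" and g: "integrable lborel g"
  shows "integrable lborel (tensor f g)"
    and "integral\<^sup>L lborel (tensor f g) = (LINT x|lborel. f x) * (LINT y|lborel. g y)"
proof -
  have [measurable]: "f \<in> borel_measurable borel" "g \<in> borel_measurable borel"
    using f g by auto
  have "integrable (lborel \<Otimes>\<^sub>M lborel) (tensor f g)"
  proof (rule lborel_pair.Fubini_integrable)
    show "tensor f g \<in> borel_measurable (lborel \<Otimes>\<^sub>M lborel)"
      unfolding tensor_def by measurable
    show "integrable lborel (\<lambda>x. LINT y|lborel. norm (tensor f g (x, y)))"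
      using f by (simp add: tensor_def abs_mult)
    show "AE x in lborel. integrable lborel (\<lambda>y. tensor f g (x, y))"
      using g by (simp add: tensor_def)
  qed
  then show *: "integrable lborel (tensor f g)" by (simp add: lborel_prod)
  show "integral\<^sup>L lborel (tensor f g) = (LINT x|lborel. f x) * (LINT y|lborel. g y)"
    by (subst integral_lborel_fst(3)[OF *, symmetric]) (simp add: tensor_def)
qed

lemma sq_integrable_tensor:
  assumes "sq_integrable f" "sq_integrable g"
  shows "sq_integrable (tensor f g)"
proof -
  have [measurable]: "f \<in> borel_measurable borel" "g \<in> borel_measurable borel"
    using assms by (auto simp: sq_integrable_def)
  have "integrable lborel (tensor (\<lambda>x. (f x)\<^sup>2) (\<lambda>x. (g x)\<^sup>2))"
    using assms by (intro integrable_tensor) (auto simp: sq_integrable_def)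
  moreover have "tensor f g \<in> borel_measurable (lborel \<Otimes>\<^sub>M lborel)"
    unfolding tensor_def by measurable
  ultimately show ?thesis
    unfolding sq_integrable_def lborel_prod by (simp add: tensor_def[abs_def] power_mult_distrib)
qed

lemma sq_integrable_swap:
  fixes k :: "real \<times> real \<Rightarrow> real"
  assumes "sq_integrable k"
  shows "sq_integrable (\<lambda>p. k (snd p, fst p))"
proof -
  have [measurable]: "k \<in> borel_measurable borel" using assms by (simp add: sq_integrable_def)
  have "(\<lambda>p::real \<times> real. (snd p, fst p)) \<in> borel_measurable borel"
    by (intro borel_measurable_continuous_onI continuous_intros)
  then have "(\<lambda>p. k (snd p, fst p)) \<in> borel_measurable borel" by (rule measurable_compose) simp
  with assms integral_lborel_swap(2)[of "\<lambda>p. (k p)\<^sup>2"] show ?thesis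
    by (simp add: sq_integrable_def)
qed

lemma sq_integrable_row:
  fixes k :: "real \<times> real \<Rightarrow> real"
  assumes "sq_integrable k"
  shows "AE x in lborel. sq_integrable (\<lambda>y. k (x, y))"
proof -
  have [measurable]: "k \<in> borel_measurable borel" using assms by (simp add: sq_integrable_def)
  have "AE x in lborel. integrable lborel (\<lambda>y. (k (x, y))\<^sup>2)"
    using integral_lborel_fst(1)[of "\<lambda>p. (k p)\<^sup>2"] assms by (simp add: sq_integrable_def)
  then show ?thesis by (simp add: sq_integrable_def)
qed

lemma sq_integrable_column:
  fixes k :: "real \<times> real \<Rightarrow> real"
  assumes "sq_integrable k"
  shows "AE y in lborel. sq_integrable (\<lambda>x. k (x, y))"
  using sq_integrable_row[OF sq_integrable_swap[OF assms]] by simp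

lemma row_norms:
  fixes k :: "real \<times> real \<Rightarrow> real"
  assumes "sq_integrable k"
  shows "integrable lborel (\<lambda>x. LINT y|lborel. (k (x, y))\<^sup>2)"
    and "(LINT x|lborel. LINT y|lborel. (k (x, y))\<^sup>2) = (LINT p|lborel. (k p)\<^sup>2)"
  using integral_lborel_fst(2,3)[of "\<lambda>p. (k p)\<^sup>2"] assms by (simp_all add: sq_integrable_def)

lemma column_norms:
  fixes k :: "real \<times> real \<Rightarrow> real"
  assumes "sq_integrable k"
  shows "integrable lborel (\<lambda>y. LINT x|lborel. (k (x, y))\<^sup>2)"
    and "(LINT y|lborel. LINT x|lborel. (k (x, y))\<^sup>2) = (LINT p|lborel. (k p)\<^sup>2)"
proof -
  have "(\<lambda>p. (k p)\<^sup>2) \<in> borel_measurable lborel" using assms by (auto simp: sq_integrable_def)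
  from integral_lborel_swap(1)[OF this] row_norms[OF sq_integrable_swap[OF assms]]
  show "integrable lborel (\<lambda>y. LINT x|lborel. (k (x, y))\<^sup>2)"
    and "(LINT y|lborel. LINT x|lborel. (k (x, y))\<^sup>2) = (LINT p|lborel. (k p)\<^sup>2)" by simp_all
qed

definition kernel_apply :: "(real \<times> real \<Rightarrow> real) \<Rightarrow> (real \<Rightarrow> real) \<Rightarrow> real \<Rightarrow> real" where
  "kernel_apply k f x = (LINT y|lborel. k (x, y) * f y)"

definition kernel_comp ::
  "(real \<times> real \<Rightarrow> real) \<Rightarrow> (real \<times> real \<Rightarrow> real) \<Rightarrow> real \<times> real \<Rightarrow> real" where
  "kernel_comp k l p = (LINT y|lborel. k (fst p, y) * l (y, snd p))"

lemma kernel_apply_sq_integrable: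
  assumes k: "sq_integrable k" and f: "sq_integrable f"
  shows "sq_integrable (kernel_apply k f)"
    and "(LINT x|lborel. (kernel_apply k f x)\<^sup>2) \<le> (LINT p|lborel. (k p)\<^sup>2) * (LINT y|lborel. (f y)\<^sup>2)"
proof -
  have [measurable]: "k \<in> borel_measurable borel" "f \<in> borel_measurable borel"
    using k f by (auto simp: sq_integrable_def)
  let ?g = "\<lambda>x. (LINT y|lborel. (k (x, y))\<^sup>2) * (LINT y|lborel. (f y)\<^sup>2)"
  have 1: "kernel_apply k f \<in> borel_measurable lborel"
    unfolding kernel_apply_def by measurable
  have 2: "integrable lborel ?g" using row_norms[OF k] by simp
  have 3: "AE x in lborel. (kernel_apply k f x)\<^sup>2 \<le> ?g x"
    using sq_integrable_row[OF k]
    by eventually_elim (auto simp: kernel_apply_def intro!: Cauchy_Schwarz_sq_integrable f)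
  show "sq_integrable (kernel_apply k f)" by (rule sq_integrable_dominated[OF 1 2 3])
  show "(LINT x|lborel. (kernel_apply k f x)\<^sup>2) \<le> (LINT p|lborel. (k p)\<^sup>2) * (LINT y|lborel. (f y)\<^sup>2)"
    using sq_integrable_dominated(2)[OF 1 2 3] row_norms[OF k] by simp
qed

text \<open>At almost every point \<open>(x, z)\<close> the composed kernel is at most the norm of the row \<open>x\<close> of \<open>k\<close> times
  the norm of the column \<open>z\<close> of \<open>l\<close>, and the square of this product integrates to the product of the
  squared norms.\<close>

lemma kernel_comp_sq_integrable:
  assumes k: "sq_integrable k" and l: "sq_integrable l"
  shows "sq_integrable (kernel_comp k l)"
    and "(LINT p|lborel. (kernel_comp k l p)\<^sup>2) \<le> (LINT p|lborel. (k p)\<^sup>2) * (LINT p|lborel. (l p)\<^sup>2)"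
proof -
  have [measurable]: "k \<in> borel_measurable borel" "l \<in> borel_measurable borel"
    using k l by (auto simp: sq_integrable_def)
  let ?g = "tensor (\<lambda>x. LINT y|lborel. (k (x, y))\<^sup>2) (\<lambda>z. LINT y|lborel. (l (y, z))\<^sup>2)"
  have "kernel_comp k l \<in> borel_measurable (borel \<Otimes>\<^sub>M borel)"
    unfolding kernel_comp_def by measurable
  then have 1: "kernel_comp k l \<in> borel_measurable lborel" by (simp add: borel_prod)
  have 2: "integrable lborel ?g" using row_norms[OF k] column_norms[OF l]
    by (intro integrable_tensor)
  have 3: "AE p in lborel. (kernel_comp k l p)\<^sup>2 \<le> ?g p"
    using AE_lborel_fst[OF sq_integrable_row[OF k]] AE_lborel_snd[OF sq_integrable_column[OF l]]
    by eventually_elim (auto simp: kernel_comp_def tensor_def intro!: Cauchy_Schwarz_sq_integrable)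
  show "sq_integrable (kernel_comp k l)" by (rule sq_integrable_dominated[OF 1 2 3])
  show "(LINT p|lborel. (kernel_comp k l p)\<^sup>2) \<le> (LINT p|lborel. (k p)\<^sup>2) * (LINT p|lborel. (l p)\<^sup>2)"
    using sq_integrable_dominated(2)[OF 1 2 3] row_norms[OF k] column_norms[OF l]
    by (simp add: integrable_tensor)
qed

text \<open>For fixed \<open>x\<close> the triple product \<open>k(x,y) l(y,z) f(z)\<close> is integrable in \<open>(y, z)\<close>: it is \<open>l\<close> times the
  tensor product of the square-integrable functions \<open>k(x,\<cdot>)\<close> and \<open>f\<close>. Hence Fubini applies.\<close>

lemma kernel_apply_comp:
  assumes k: "sq_integrable k" and l: "sq_integrable l" and f: "sq_integrable f"
  shows "AE x in lborel. kernel_apply (kernel_comp k l) f x = kernel_apply k (kernel_apply l f) x"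
  using sq_integrable_row[OF k]
proof eventually_elim
  case (elim x)
  have "integrable lborel (\<lambda>p. tensor (\<lambda>y. k (x, y)) f p * l p)"
    by (intro sq_integrable_mult sq_integrable_tensor elim f l)
  then have int: "integrable (lborel \<Otimes>\<^sub>M lborel) (case_prod (\<lambda>y z. k (x, y) * f z * l (y, z)))"
    by (simp add: tensor_def lborel_prod case_prod_unfold)
  have "kernel_apply (kernel_comp k l) f x = (LINT z|lborel. LINT y|lborel. k (x, y) * f z * l (y, z))"
    by (simp add: kernel_apply_def kernel_comp_def ac_simps flip: integral_mult_left_zero integral_mult_right_zero)
  also have "\<dots> = (LINT y|lborel. LINT z|lborel. k (x, y) * f z * l (y, z))"
    by (rule lborel_pair.Fubini_integral[OF int])
  also have "\<dots> = kernel_apply k (kernel_apply l f) x"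
    by (simp add: kernel_apply_def ac_simps flip: integral_mult_left_zero integral_mult_right_zero)
  finally show ?case .
qed

section \<open>Integral operators with square-integrable kernel\<close>

lemma integral_tensor_kernel:
  assumes k: "sq_integrable k" and f: "sq_integrable f" and g: "sq_integrable g"
  shows "(LINT x|lborel. g x * kernel_apply k f x) = (LINT p|lborel. tensor g f p * k p)"
proof -
  have "integrable lborel (\<lambda>p. tensor g f p * k p)"
    by (intro sq_integrable_mult sq_integrable_tensor k f g)
  from integral_lborel_fst(3)[OF this] show ?thesis
    by (simp add: kernel_apply_def tensor_def ac_simps
        flip: integral_mult_left_zero integral_mult_right_zero)
qed

lemma sq_integrable_indicator:
  "A \<in> sets borel \<Longrightarrow> emeasure lborel A < \<infinity> \<Longrightarrow> sq_integrable (indicator A)"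
proof -
  have "(\<lambda>x. (indicator A x :: real)\<^sup>2) = indicator A" by (auto simp: indicator_def)
  then show "A \<in> sets borel \<Longrightarrow> emeasure lborel A < \<infinity> \<Longrightarrow> sq_integrable (indicator A)"
    by (auto simp: sq_integrable_def intro!: integrable_real_indicator)
qed

text \<open>Uniqueness of the kernel. The null set in the hypothesis depends on \<open>f\<close>, so a vanishing of almost
  all rows cannot be read off directly. Instead the hypothesis is integrated against a second
  function: \<open>k\<close> is orthogonal to all tensor products, in particular to the indicators of bounded
  rectangles. Bounded rectangles generate the Borel sets of the plane.\<close>

lemma kernel_eq_zero:
  assumes k: "sq_integrable k"
    and 0: "\<And>f. sq_integrable f \<Longrightarrow> AE x in lborel. kernel_apply k f x = 0"
  shows "AE p in lborel. k p = 0"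
proof -
  \<comment> \<open>Bounded windows: \<open>k\<close> itself need not be integrable over the whole plane.\<close>
  define C where "C n = {- real n..real n}" for n
  have [measurable]: "k \<in> borel_measurable borel" using k by (simp add: sq_integrable_def)
  have rect: "(LINT p|lborel. tensor g f p * k p) = 0" if f: "sq_integrable f" and g: "sq_integrable g" for f g
  proof -
    have "(LINT x|lborel. g x * kernel_apply k f x) = (LINT x|(lborel :: real measure). 0)"
    proof (rule integral_cong_AE)
      show "(\<lambda>x. g x * kernel_apply k f x) \<in> borel_measurable lborel"
        using sq_integrable_mult[OF g kernel_apply_sq_integrable(1)[OF k f]] by auto
    qed (use 0[OF f] in auto)
    then show ?thesis by (simp add: integral_tensor_kernel[OF k f g])
  qed
  have ind: "sq_integrable (indicator (C n \<inter> A) :: real \<Rightarrow> real)" if "A \<in> sets borel" for n A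
  proof (rule sq_integrable_indicator)
    have "emeasure lborel (C n \<inter> A) \<le> emeasure lborel (C n)"
      using that by (intro emeasure_mono) (auto simp: C_def)
    then show "emeasure lborel (C n \<inter> A) < \<infinity>" by (simp add: C_def le_less_trans)
  qed (use that in \<open>auto simp: C_def\<close>)
  define h where "h n p = tensor (indicator (C n)) (indicator (C n)) p * k p" for n p
  have h: "integrable lborel (h n)" for n
    unfolding h_def[abs_def] using ind[of UNIV n]
    by (intro sq_integrable_mult sq_integrable_tensor k) auto
  have hs: "set_integrable lborel A (h n)" if "A \<in> sets borel" for A n
    unfolding set_integrable_def using h that by (intro integrable_mult_indicator) auto
  have "AE p in lborel. h n p = 0" for n
  proof (rule sigma_finite_measure.density_zero[OF sigma_finite_lborel h])
    fix A :: "(real \<times> real) set" assume "A \<in> sets lborel"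
    define G where "G = {a \<times> b |a b. a \<in> sets (borel :: real measure) \<and> b \<in> sets (borel :: real measure)}"
    have "Int_stable G"
      unfolding G_def by (rule Int_stable_pair_measure_generator)
    moreover have "G \<subseteq> Pow UNIV" by auto
    moreover have "A \<in> sigma_sets UNIV G"
      using \<open>A \<in> sets lborel\<close> sets_pair_measure[of "borel :: real measure" "borel :: real measure"]
      unfolding borel_prod G_def by simp
    ultimately have "A \<in> sets borel \<and> set_lebesgue_integral lborel A (h n) = 0"
    proof (induction rule: sigma_sets_induct_disjoint)
      case (basic A)
      then obtain a b where A: "A = a \<times> b" "a \<in> sets borel" "b \<in> sets borel" by (auto simp: G_def)
      have "indicator A p * h n p = tensor (indicator (C n \<inter> a)) (indicator (C n \<inter> b)) p * k p" for p
        by (cases p) (auto simp: A h_def tensor_def indicator_def)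
      with rect[OF ind[OF A(3)] ind[OF A(2)]] A show ?case
        by (simp add: set_lebesgue_integral_def borel_prod[symmetric])
    next
      case empty
      show ?case by (simp add: set_lebesgue_integral_def)
    next
      case (compl A)
      have "h n = (\<lambda>p. tensor (indicator (C n \<inter> UNIV)) (indicator (C n \<inter> UNIV)) p * k p)"
        by (simp add: h_def fun_eq_iff)
      then have "integral\<^sup>L lborel (h n) = 0"
        using rect[OF ind[of UNIV n] ind[of UNIV n]] by simp
      moreover have "set_lebesgue_integral lborel (UNIV - A) (h n)
          = integral\<^sup>L lborel (h n) - set_lebesgue_integral lborel A (h n)"
      proof -
        have "set_integrable lborel (UNIV - A) (h n)" "set_integrable lborel A (h n)"
          using compl by (auto intro!: hs)
        from set_integral_Un[OF Diff_disjoint[of A UNIV, unfolded Int_commute[of A]] this] show ?thesis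
          by (simp add: set_lebesgue_integral_def)
      qed
      ultimately show ?case using compl by auto
    next
      case (union A)
      then have "set_lebesgue_integral lborel (\<Union>i. A i) (h n) = (\<Sum>i. set_lebesgue_integral lborel (A i) (h n))"
        by (intro lebesgue_integral_countable_add hs) (auto simp: disjoint_family_on_def)
      with union show ?case by auto
    qed
    then show "set_lebesgue_integral lborel A (h n) = 0" by simp
  qed
  then have "AE p in lborel. \<forall>n. h n p = 0" by (simp add: AE_all_countable)
  then show ?thesis
  proof eventually_elim
    case (elim p)
    obtain n where "max \<bar>fst p\<bar> \<bar>snd p\<bar> \<le> real n" using real_arch_simple by blast
    then have "fst p \<in> C n" "snd p \<in> C n" by (auto simp: C_def)
    with elim[rule_format, of n] show ?case by (simp add: h_def tensor_def)
  qed
qed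

type_synonym L2_kernel = "(real \<times> real) L2"

lemma abs_L2_eq_iff:
  assumes "sq_integrable f" "sq_integrable g"
  shows "abs_L2 f = abs_L2 g \<longleftrightarrow> (AE x in lborel. f x = g x)"
  using Quotient3_rel[OF Quotient3_L2, of f g] assms by (simp add: L2_rel_def)

lemma norm_L2_le_iff:
  fixes f :: "'a::euclidean_space L2" and g :: "'b::euclidean_space L2" and h :: "'c::euclidean_space L2"
  shows "norm f \<le> norm g \<longleftrightarrow> f \<bullet> f \<le> g \<bullet> g"
    and "norm f \<le> norm g * norm h \<longleftrightarrow> f \<bullet> f \<le> (g \<bullet> g) * (h \<bullet> h)"
  by (simp_all add: norm_L2_def flip: real_sqrt_mult)

lemma AE_integrable_row_mult:
  fixes k :: "real \<times> real \<Rightarrow> real"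
  assumes "sq_integrable k" "sq_integrable f"
  shows "AE x in lborel. integrable lborel (\<lambda>y. k (x, y) * f y)"
  using sq_integrable_row[OF assms(1)] by eventually_elim (intro sq_integrable_mult assms)

lift_definition kapply :: "L2_kernel \<Rightarrow> real L2 \<Rightarrow> real L2" is kernel_apply
proof -
  fix k k' :: "real \<times> real \<Rightarrow> real" and f f' :: "real \<Rightarrow> real"
  assume "L2_rel k k'" "L2_rel f f'"
  then have k: "sq_integrable k" and k': "sq_integrable k'" and kk': "AE p in lborel. k p = k' p"
    and f: "sq_integrable f" and f': "sq_integrable f'" and ff': "AE y in lborel. f y = f' y"
    by (auto simp: L2_rel_def)
  have [measurable]: "k \<in> borel_measurable borel" "f \<in> borel_measurable borel"
    "k' \<in> borel_measurable borel" "f' \<in> borel_measurable borel"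
    using k f k' f' by (auto simp: sq_integrable_def)
  have "AE x in lborel. kernel_apply k f x = kernel_apply k' f' x"
    using AE_lborel_sections[OF kk']
  proof eventually_elim
    case (elim x)
    then have "AE y in lborel. k (x, y) * f y = k' (x, y) * f' y"
      using ff' by eventually_elim simp
    then show ?case unfolding kernel_apply_def by (intro integral_cong_AE) auto
  qed
  then show "L2_rel (kernel_apply k f) (kernel_apply k' f')"
    by (simp add: L2_rel_def kernel_apply_sq_integrable k k' f f')
qed

lift_definition kcomp :: "L2_kernel \<Rightarrow> L2_kernel \<Rightarrow> L2_kernel" is kernel_comp
proof -
  fix k k' l l' :: "real \<times> real \<Rightarrow> real"
  assume "L2_rel k k'" "L2_rel l l'"
  then have k: "sq_integrable k" and k': "sq_integrable k'" and kk': "AE p in lborel. k p = k' p"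
    and l: "sq_integrable l" and l': "sq_integrable l'" and ll': "AE p in lborel. l p = l' p"
    by (auto simp: L2_rel_def)
  have [measurable]: "k \<in> borel_measurable borel" "l \<in> borel_measurable borel"
    "k' \<in> borel_measurable borel" "l' \<in> borel_measurable borel"
    using k l k' l' by (auto simp: sq_integrable_def)
  have "AE p in lborel. kernel_comp k l p = kernel_comp k' l' p"
    using AE_lborel_fst[OF AE_lborel_sections[OF kk']] AE_lborel_snd[OF AE_lborel_sections'[OF ll']]
  proof eventually_elim
    case (elim p)
    then have "AE y in lborel. k (fst p, y) * l (y, snd p) = k' (fst p, y) * l' (y, snd p)"
      by eventually_elim simp
    then show ?case unfolding kernel_comp_def by (intro integral_cong_AE) auto
  qed
  then show "L2_rel (kernel_comp k l) (kernel_comp k' l')"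
    by (simp add: L2_rel_def kernel_comp_sq_integrable k k' l l')
qed

lift_definition ktrans :: "L2_kernel \<Rightarrow> L2_kernel" is "\<lambda>k p. k (snd p, fst p)"
proof -
  fix k k' :: "real \<times> real \<Rightarrow> real"
  assume "L2_rel k k'"
  then show "L2_rel (\<lambda>p. k (snd p, fst p)) (\<lambda>p. k' (snd p, fst p))"
    using AE_lborel_swap[of "\<lambda>p. k p = k' p"] by (simp add: L2_rel_def sq_integrable_swap)
qed

lemma sq_integrable_if:
  assumes "sq_integrable k" "{p. P p} \<in> sets borel"
  shows "sq_integrable (\<lambda>p. if P p then k p else 0)"
proof (rule sq_integrable_dominated(1))
  have [measurable]: "Measurable.pred borel P" using assms(2) by (simp add: pred_def)
  have [measurable]: "k \<in> borel_measurable borel" using assms by (simp add: sq_integrable_def)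
  show "(\<lambda>p. if P p then k p else 0) \<in> borel_measurable lborel" by simp
  show "integrable lborel (\<lambda>p. (k p)\<^sup>2)" using assms(1) by (simp add: sq_integrable_def)
qed auto

lemma lower_triangle_borel: "{p :: real \<times> real. snd p \<le> fst p} \<in> sets borel"
  by (intro borel_closed closed_Collect_le continuous_intros)

text \<open>The orthogonal projection of \<open>L\<^sup>2(\<real>\<^sup>2)\<close> onto the kernels that vanish for \<open>y > x\<close>. A kernel is of
  Volterra type when it is fixed by this projection.\<close>

lift_definition ktri :: "L2_kernel \<Rightarrow> L2_kernel" is "\<lambda>k p. if snd p \<le> fst p then k p else 0"
  by (auto simp: L2_rel_def intro!: sq_integrable_if lower_triangle_borel)

lemma norm_kapply_le: "norm (kapply k f) \<le> norm k * norm f"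
  unfolding norm_L2_le_iff
proof (transfer, goal_cases)
  case (1 k f)
  then show ?case
    using kernel_apply_sq_integrable(2)[of k f] by (simp add: L2_rel_def power2_eq_square)
qed

lemma norm_kcomp_le: "norm (kcomp k l) \<le> norm k * norm l"
  unfolding norm_L2_le_iff
proof (transfer, goal_cases)
  case (1 k l)
  then show ?case
    using kernel_comp_sq_integrable(2)[of k l] by (simp add: L2_rel_def power2_eq_square)
qed

lemma norm_ktrans: "norm (ktrans k) = norm k"
  unfolding norm_L2_def
proof (transfer, goal_cases)
  case (1 k)
  then have "(\<lambda>p. k p * k p) \<in> borel_measurable lborel"
    by (auto simp: L2_rel_def sq_integrable_def)
  from integral_lborel_swap(1)[OF this] show ?case by simp
qed

lemma norm_ktri_le: "norm (ktri k) \<le> norm k"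
  unfolding norm_L2_le_iff
proof (transfer, goal_cases)
  case (1 k)
  then have k: "sq_integrable k" by (simp add: L2_rel_def)
  then show ?case
    using sq_integrable_mult[OF k k]
      sq_integrable_mult[OF sq_integrable_if[OF k lower_triangle_borel] sq_integrable_if[OF k lower_triangle_borel]]
    by (intro integral_mono) auto
qed

lemma kapply_add_left: "kapply (k + k') f = kapply k f + kapply k' f"
proof (transfer, goal_cases)
  case (1 k k' f)
  then have *: "sq_integrable k" "sq_integrable k'" "sq_integrable f" by (auto simp: L2_rel_def)
  have "AE x in lborel. kernel_apply (\<lambda>p. k p + k' p) f x = kernel_apply k f x + kernel_apply k' f x"
    using AE_integrable_row_mult[OF *(1,3)] AE_integrable_row_mult[OF *(2,3)]
    by eventually_elim (simp add: kernel_apply_def distrib_right)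
  with * show ?case by (simp add: L2_rel_def kernel_apply_sq_integrable sq_integrable_add)
qed

lemma kapply_add_right: "kapply k (f + f') = kapply k f + kapply k f'"
proof (transfer, goal_cases)
  case (1 k f f')
  then have *: "sq_integrable k" "sq_integrable f" "sq_integrable f'" by (auto simp: L2_rel_def)
  have "AE x in lborel. kernel_apply k (\<lambda>y. f y + f' y) x = kernel_apply k f x + kernel_apply k f' x"
    using AE_integrable_row_mult[OF *(1,2)] AE_integrable_row_mult[OF *(1,3)]
    by eventually_elim (simp add: kernel_apply_def distrib_left)
  with * show ?case by (simp add: L2_rel_def kernel_apply_sq_integrable sq_integrable_add)
qed

lemma kapply_scaleR_left: "kapply (c *\<^sub>R k) f = c *\<^sub>R kapply k f"
proof (transfer, goal_cases)
  case (1 c k f)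
  then show ?case
    by (simp add: L2_rel_def kernel_apply_sq_integrable sq_integrable_scale)
      (simp add: kernel_apply_def mult.assoc)
qed

lemma kapply_scaleR_right: "kapply k (c *\<^sub>R f) = c *\<^sub>R kapply k f"
proof (transfer, goal_cases)
  case (1 k c f)
  then show ?case
    by (simp add: L2_rel_def kernel_apply_sq_integrable sq_integrable_scale)
      (simp add: kernel_apply_def mult.left_commute)
qed

lemma kapply_kcomp: "kapply (kcomp k l) f = kapply k (kapply l f)"
  by transfer (simp add: L2_rel_def kernel_apply_sq_integrable kernel_comp_sq_integrable kernel_apply_comp)

lemma kapply_ktrans: "kapply (ktrans k) f \<bullet> g = f \<bullet> kapply k g"
proof (transfer, goal_cases)
  case (1 k f g)
  then have *: "sq_integrable k" "sq_integrable f" "sq_integrable g" by (auto simp: L2_rel_def)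
  have "(\<lambda>p. tensor f g p * k p) \<in> borel_measurable lborel"
    using sq_integrable_mult[OF sq_integrable_tensor[OF *(2,3)] *(1)] by auto
  from integral_lborel_swap(1)[OF this] show ?case
    using integral_tensor_kernel[OF *(1,3,2)] integral_tensor_kernel[OF sq_integrable_swap[OF *(1)] *(2,3)]
    by (simp add: tensor_def ac_simps)
qed

lemma kapply_eq_zero:
  assumes "\<And>f. kapply k f = 0"
  shows "k = 0"
  using assms
proof (transfer, goal_cases)
  case (1 k)
  then have k: "sq_integrable k" by (simp add: L2_rel_def)
  have "AE x in lborel. kernel_apply k f x = 0" if "sq_integrable f" for f
    using 1(2)[of f] that by (simp add: L2_rel_def)
  from kernel_eq_zero[OF k this] show ?case by (simp add: L2_rel_def k sq_integrable_zero)
qed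

lemma bounded_bilinear_kapply: "bounded_bilinear kapply"
  by unfold_locales
    (auto simp: kapply_add_left kapply_add_right kapply_scaleR_left kapply_scaleR_right
      intro!: exI[of _ 1] norm_kapply_le)

definition Op :: "L2_kernel \<Rightarrow> operator" where "Op k = Blinfun (kapply k)"

lemma Op_apply [simp]: "blinfun_apply (Op k) = kapply k"
  unfolding Op_def
  by (rule bounded_linear_Blinfun_apply[OF bounded_bilinear.bounded_linear_right[OF bounded_bilinear_kapply]])

lemma bounded_linear_Op: "bounded_linear Op"
proof (rule bounded_linear_intro[where K = 1])
  show "norm (Op k) \<le> norm k * 1" for k
    by (rule norm_blinfun_bound) (simp_all add: norm_kapply_le)
qed (auto intro!: blinfun_eqI simp: kapply_add_left kapply_scaleR_left blinfun.add_left blinfun.scaleR_left)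

lemma Op_kcomp: "Op (kcomp k l) = Op k o\<^sub>L Op l"
  by (rule blinfun_eqI) (simp add: kapply_kcomp)

lemma Op_eq_iff [simp]: "Op k = Op l \<longleftrightarrow> k = l"
proof
  assume "Op k = Op l"
  then have "Op (k - l) = 0"
    by (simp add: linear_diff[OF bounded_linear.linear[OF bounded_linear_Op]])
  then have "kapply (k - l) f = 0" for f
    by (metis Op_apply blinfun.zero_left)
  then have "k - l = 0" by (rule kapply_eq_zero)
  then show "k = l" by simp
qed simp

text \<open>The algebraic laws of the composition of kernels follow from those of operators, since an operator
  determines its kernel.\<close>

lemma kcomp_assoc: "kcomp (kcomp a b) c = kcomp a (kcomp b c)"
  by (simp flip: Op_eq_iff add: Op_kcomp) (rule blinfun_eqI, simp)

lemma Op_linear: "Op (a + b) = Op a + Op b" "Op (r *\<^sub>R a) = r *\<^sub>R Op a" "Op 0 = 0"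
  "Op (- a) = - Op a" "Op (a - b) = Op a - Op b"
  using bounded_linear_Op
  by (simp_all add: bounded_linear.linear linear_add linear_scale linear_0 linear_neg linear_diff)

lemma kcomp_linear:
  "kcomp (a + b) c = kcomp a c + kcomp b c" "kcomp a (b + c) = kcomp a b + kcomp a c"
  "kcomp (r *\<^sub>R a) b = r *\<^sub>R kcomp a b" "kcomp a (r *\<^sub>R b) = r *\<^sub>R kcomp a b"
  by (simp_all flip: Op_eq_iff
      add: Op_kcomp Op_linear bounded_bilinear.add_left[OF bounded_bilinear_blinfun_compose]
        bounded_bilinear.add_right[OF bounded_bilinear_blinfun_compose]
        bounded_bilinear.scaleR_left[OF bounded_bilinear_blinfun_compose]
        bounded_bilinear.scaleR_right[OF bounded_bilinear_blinfun_compose])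

lemma ktrans_linear: "ktrans (a + b) = ktrans a + ktrans b" "ktrans (r *\<^sub>R a) = r *\<^sub>R ktrans a"
  by (transfer, simp add: L2_rel_def sq_integrable_swap sq_integrable_add sq_integrable_scale)+

lemma ktrans_ktrans: "ktrans (ktrans a) = a"
  by transfer (simp add: L2_rel_def)

lemma ktrans_kcomp: "ktrans (kcomp a b) = kcomp (ktrans b) (ktrans a)"
proof (transfer, goal_cases)
  case (1 a b)
  have "(\<lambda>p. kernel_comp a b (snd p, fst p))
      = kernel_comp (\<lambda>p. b (snd p, fst p)) (\<lambda>p. a (snd p, fst p))"
    by (simp add: kernel_comp_def fun_eq_iff mult.commute)
  with 1 show ?case
    by (simp add: L2_rel_def kernel_comp_sq_integrable sq_integrable_swap)
qed

lemma ktri_linear: "ktri (a + b) = ktri a + ktri b" "ktri (r *\<^sub>R a) = r *\<^sub>R ktri a"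
  by (transfer, simp add: L2_rel_def sq_integrable_if lower_triangle_borel
      sq_integrable_add sq_integrable_scale)+

lemma ktri_ktri: "ktri (ktri a) = ktri a"
  by transfer (simp add: L2_rel_def sq_integrable_if lower_triangle_borel cong: if_cong)

text \<open>The two closed triangles overlap only in the diagonal, a null set.\<close>

lemma ktri_split: "ktri a + ktrans (ktri (ktrans a)) = a"
proof (transfer, goal_cases)
  case (1 a)
  then have a: "sq_integrable a" by (simp add: L2_rel_def)
  let ?l = "\<lambda>a p. if snd p \<le> fst p then a p else (0::real)"
  have *: "sq_integrable (\<lambda>p. ?l a p + ?l (\<lambda>p. a (snd p, fst p)) (snd p, fst p))"
    by (intro sq_integrable_add sq_integrable_if lower_triangle_borel a
        sq_integrable_swap[where k = "?l (\<lambda>p. a (snd p, fst p))"] sq_integrable_swap[OF a])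
  have "AE p in lborel. ?l a p + ?l (\<lambda>p. a (snd p, fst p)) (snd p, fst p) = a p"
    using AE_off_diagonal by eventually_elim auto
  with * a show ?case by (simp add: L2_rel_def)
qed

lemma ktri_eq_iff: "ktri (abs_L2 a) = abs_L2 a \<longleftrightarrow> (AE p in lborel. snd p > fst p \<longrightarrow> a p = 0)"
  if a: "sq_integrable a"
proof -
  let ?l = "\<lambda>p. if snd p \<le> fst p then a p else (0::real)"
  have l: "sq_integrable ?l" by (intro sq_integrable_if lower_triangle_borel a)
  have "ktri (abs_L2 a) = abs_L2 ?l"
    using a by (simp add: ktri.abs_eq L2_rel_def)
  moreover have "abs_L2 ?l = abs_L2 a \<longleftrightarrow> (AE p in lborel. snd p > fst p \<longrightarrow> a p = 0)"
    using a l by (simp add: abs_L2_eq_iff) (auto elim!: eventually_mono)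
  ultimately show ?thesis by simp
qed

text \<open>If \<open>z > x\<close>, then every \<open>y\<close> satisfies \<open>y > x\<close> or \<open>z > y\<close>, so one of the factors of
  \<open>a(x,y) b(y,z)\<close> vanishes.\<close>

lemma ktri_kcomp:
  assumes "ktri a = a" "ktri b = b"
  shows "ktri (kcomp a b) = kcomp a b"
proof -
  define k l where "k = rep_L2 a" and "l = rep_L2 b"
  have k: "sq_integrable k" and l: "sq_integrable l"
    by (simp_all add: k_def l_def sq_integrable_rep)
  have kl: "a = abs_L2 k" "b = abs_L2 l" by (simp_all add: k_def l_def abs_rep_L2)
  have k0: "AE p in lborel. snd p > fst p \<longrightarrow> k p = 0" and l0: "AE p in lborel. snd p > fst p \<longrightarrow> l p = 0"
    using assms by (simp_all add: kl ktri_eq_iff k l)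
  have "AE p in lborel. snd p > fst p \<longrightarrow> kernel_comp k l p = 0"
    using AE_lborel_fst[OF AE_lborel_sections[OF k0]] AE_lborel_snd[OF AE_lborel_sections'[OF l0]]
  proof eventually_elim
    case (elim p)
    show ?case
    proof
      assume "snd p > fst p"
      have "AE y in lborel. k (fst p, y) * l (y, snd p) = 0"
        using elim
      proof eventually_elim
        case (elim y)
        with \<open>snd p > fst p\<close> show ?case by (cases "y \<le> fst p") auto
      qed
      then show "kernel_comp k l p = 0"
        unfolding kernel_comp_def by (rule integral_eq_zero_AE)
    qed
  qed
  moreover have "kcomp a b = abs_L2 (kernel_comp k l)"
    using k l by (simp add: kl kcomp.abs_eq L2_rel_def)
  ultimately show ?thesis
    by (simp add: ktri_eq_iff kernel_comp_sq_integrable k l)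
qed

section \<open>Inverses of Volterra operators\<close>

text \<open>Indefinite integrals of nonnegative functions as cumulative distribution functions of measures
  without atoms: this provides their continuity and their limit at \<open>-\<infinity>\<close>.\<close>

lemma cdf_density_lborel:
  fixes g :: "real \<Rightarrow> real"
  assumes g: "integrable lborel g" and nonneg: "\<And>x. 0 \<le> g x"
  defines "M \<equiv> density lborel (\<lambda>x. ennreal (g x))"
  shows "finite_borel_measure M"
    and "cdf M x = (LINT y|lborel. indicator {..x} y * g y)"
    and "measure M {x} = 0"
proof -
  have [measurable]: "g \<in> borel_measurable borel" using g by auto
  have em: "emeasure M A = ennreal (LINT y|lborel. indicator A y * g y)" if "A \<in> sets borel" for A
  proof -
    have "emeasure M A = (\<integral>\<^sup>+y. ennreal (indicator A y * g y) \<partial>lborel)"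
      using that unfolding M_def
      by (subst emeasure_density) (auto intro!: nn_integral_cong simp: indicator_def)
    also have "\<dots> = ennreal (LINT y|lborel. indicator A y * g y)"
      using that g nonneg integrable_mult_indicator[OF _ g, of A]
      by (intro nn_integral_eq_integral) auto
    finally show ?thesis .
  qed
  have "finite_measure M"
    by standard (use em[of UNIV] in \<open>simp add: M_def\<close>)
  then show "finite_borel_measure M"
    by (simp add: finite_borel_measure_def finite_borel_measure_axioms_def M_def)
  show "cdf M x = (LINT y|lborel. indicator {..x} y * g y)"
    using em[of "{..x}"] nonneg by (simp add: cdf_def measure_def integral_nonneg_AE)
  have "AE y in lborel. indicator {x} y * g y = 0"
    using AE_lborel_singleton[of x] by eventually_elim simp
  then have "(LINT y|lborel. indicator {x} y * g y) = 0"
    by (rule integral_eq_zero_AE)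
  then show "measure M {x} = 0"
    using em[of "{x}"] by (simp add: measure_def)
qed

text \<open>Let \<open>N\<close> and \<open>F\<close> be the indefinite integrals of \<open>\<epsilon>\<close> and \<open>\<alpha>\<close> from \<open>-\<infinity>\<close>. The hypothesis and the
  monotonicity of \<open>N\<close> give \<open>N(x) - N(u) \<le> N(x) (F(x) - F(u))\<close> for \<open>u \<le> x\<close>. Hence a zero of \<open>N\<close> at \<open>u\<close>
  propagates to every \<open>x\<close> with \<open>F(x) - F(u) < 1\<close>. The limit \<open>u \<rightarrow> -\<infinity>\<close> provides a first zero, and by
  continuity of \<open>N\<close> and \<open>F\<close> the zeros of \<open>N\<close> cannot end anywhere.\<close>

lemma Gronwall_zero:
  fixes \<alpha> \<epsilon> :: "real \<Rightarrow> real"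
  assumes a: "integrable lborel \<alpha>" "\<And>x. 0 \<le> \<alpha> x"
    and e: "integrable lborel \<epsilon>" "\<And>x. 0 \<le> \<epsilon> x"
    and le: "AE x in lborel. \<epsilon> x \<le> \<alpha> x * (LINT y|lborel. indicator {..x} y * \<epsilon> y)"
  shows "AE x in lborel. \<epsilon> x = 0"
proof -
  define F where "F x = (LINT y|lborel. indicator {..x} y * \<alpha> y)" for x :: real
  define N where "N x = (LINT y|lborel. indicator {..x} y * \<epsilon> y)" for x :: real
  interpret A: finite_borel_measure "density lborel (\<lambda>x. ennreal (\<alpha> x))"
    by (rule cdf_density_lborel(1)[OF a])
  interpret E: finite_borel_measure "density lborel (\<lambda>x. ennreal (\<epsilon> x))"
    by (rule cdf_density_lborel(1)[OF e])
  have F: "F = cdf (density lborel (\<lambda>x. ennreal (\<alpha> x)))"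
    by (simp add: fun_eq_iff F_def cdf_density_lborel(2)[OF a])
  have N: "N = cdf (density lborel (\<lambda>x. ennreal (\<epsilon> x)))"
    by (simp add: fun_eq_iff N_def cdf_density_lborel(2)[OF e])
  have F_cont: "isCont F x" for x
    unfolding F by (simp add: A.isCont_cdf cdf_density_lborel(3)[OF a])
  have N_cont: "isCont N x" for x
    unfolding N by (simp add: E.isCont_cdf cdf_density_lborel(3)[OF e])
  have F_bot: "(F \<longlongrightarrow> 0) at_bot" unfolding F by (rule A.cdf_lim_at_bot)
  have N_bot: "(N \<longlongrightarrow> 0) at_bot" unfolding N by (rule E.cdf_lim_at_bot)
  have N_mono: "N x \<le> N y" if "x \<le> y" for x y
    unfolding N by (rule E.cdf_nondecreasing[OF that])
  have N_nonneg: "0 \<le> N x" for x unfolding N by (rule E.cdf_nonneg)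
  have ind: "integrable lborel (\<lambda>y. indicator S y * g y)"
    if "integrable lborel g" "S \<in> sets borel" for g :: "real \<Rightarrow> real" and S :: "real set"
    using integrable_mult_indicator[of S lborel g] that by simp
  have key: "N x - N u \<le> N x * (F x - F u)" if "u \<le> x" for u x
  proof -
    have split: "indicator {..x} y - indicator {..u} y = (indicator {u<..x} y :: real)" for y
      using that by (auto simp: indicator_def)
    have "N x - N u = (LINT y|lborel. indicator {u<..x} y * \<epsilon> y)"
      unfolding N_def split[symmetric] left_diff_distrib
      by (rule Bochner_Integration.integral_diff[symmetric]) (auto intro!: ind e)
    also have "\<dots> \<le> (LINT y|lborel. N x * (indicator {u<..x} y * \<alpha> y))"
    proof (rule integral_mono_AE)
      show "AE y in lborel. indicator {u<..x} y * \<epsilon> y \<le> N x * (indicator {u<..x} y * \<alpha> y)"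
        using le
      proof eventually_elim
        case (elim y)
        have "\<epsilon> y \<le> N x * \<alpha> y" if "y \<le> x"
        proof -
          have "\<epsilon> y \<le> \<alpha> y * N y" using elim by (simp add: N_def)
          also have "\<dots> \<le> \<alpha> y * N x" by (intro mult_left_mono N_mono that a)
          finally show ?thesis by (simp add: mult.commute)
        qed
        then show ?case by (simp add: indicator_def)
      qed
    qed (auto intro!: ind e a)
    also have "\<dots> = N x * (F x - F u)"
    proof -
      have "F x - F u = (LINT y|lborel. indicator {u<..x} y * \<alpha> y)"
        unfolding F_def split[symmetric] left_diff_distrib
        by (rule Bochner_Integration.integral_diff[symmetric]) (auto intro!: ind a)
      then show ?thesis by simp
    qed
    finally show ?thesis .
  qed
  have zero: "N x = 0" if "N u = 0" "u \<le> x" "F x - F u < 1" for u x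
  proof (rule ccontr)
    assume "N x \<noteq> 0"
    then have "0 < N x" using N_nonneg[of x] by simp
    then have "N x * (F x - F u) < N x * 1" using that by (intro mult_strict_left_mono)
    with key[of u x] that show False by simp
  qed
  have "\<exists>x. N x = 0"
  proof -
    have "\<forall>\<^sub>F x in at_bot. F x < 1" using F_bot by (rule order_tendstoD) simp
    then obtain x where x: "F x < 1" by (auto simp: eventually_at_bot_linorder)
    have "((\<lambda>u. N x - N u) \<longlongrightarrow> N x - 0) at_bot" "((\<lambda>u. N x * (F x - F u)) \<longlongrightarrow> N x * (F x - 0)) at_bot"
      by (intro tendsto_intros N_bot F_bot)+
    moreover have "\<forall>\<^sub>F u in at_bot. N x - N u \<le> N x * (F x - F u)"
      using eventually_le_at_bot[of x] by eventually_elim (rule key)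
    ultimately have "N x \<le> N x * F x"
      using tendsto_le[OF trivial_limit_at_bot_linorder, of _ "N x * (F x - 0)" _ "N x - 0"] by simp
    then have "N x = 0"
      using N_nonneg[of x] x mult_strict_left_mono[of "F x" 1 "N x"] by fastforce
    then show ?thesis ..
  qed
  moreover have "closed {x. N x = 0}"
    using N_cont by (intro closed_Collect_eq continuous_at_imp_continuous_on) auto
  moreover have "N x = 0" if "N u = 0" "closed {x. N x = 0}" for x u
  proof (rule ccontr)
    assume x: "N x \<noteq> 0"
    have bdd: "bdd_above {x. N x = 0}"
    proof (rule bdd_aboveI)
      fix y assume "y \<in> {x. N x = 0}"
      then show "y \<le> x" using N_mono[of x y] N_nonneg[of x] x by fastforce
    qed
    define s where "s = Sup {x. N x = 0}"
    have s: "N s = 0"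
      using closed_contains_Sup[OF _ bdd that(2)] that(1) unfolding s_def by auto
    have "\<forall>\<^sub>F y in at_right s. F y < F s + 1"
      using F_cont[of s] by (intro order_tendstoD) (auto simp: isCont_def filterlim_at_split)
    then obtain b where b: "s < b" "\<And>y. s < y \<Longrightarrow> y < b \<Longrightarrow> F y < F s + 1"
      by (auto simp: eventually_at_right_field)
    obtain y where y: "s < y" "y < b" using dense[OF b(1)] by auto
    have "N y = 0" using zero[of s y] s y b(2)[of y] by simp
    then have "y \<le> s" unfolding s_def by (intro cSup_upper bdd) auto
    with y show False by simp
  qed
  ultimately have N0: "N x = 0" for x by blast
  have "AE y in lborel. indicator {..x} y * \<epsilon> y = 0" for x
    using N0[of x] integral_nonneg_eq_0_iff_AE[OF ind[OF e(1), of "{..x}"]] e(2)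
    by (simp add: N_def)
  then have "AE y in lborel. \<forall>n::nat. indicator {..real n} y * \<epsilon> y = 0"
    unfolding AE_all_countable by blast
  then show ?thesis
  proof eventually_elim
    case (elim y)
    obtain n where "y \<le> real n" using real_arch_simple by blast
    with elim[rule_format, of n] show ?case by simp
  qed
qed

text \<open>Above the diagonal the equation reads \<open>e(x,z) = - \<integral>\<^bsub>y\<le>x\<^esub> a(x,y) e(y,z) dy\<close>, and below it \<open>e = 0\<close>. For
  fixed \<open>x\<close> the right-hand side applies the transpose of \<open>e\<close>, cut off at \<open>y \<le> x\<close>, to the row
  \<open>a(x,\<cdot>)\<close>. So the squared row norms \<open>\<epsilon>\<close> of \<open>e\<close> and \<open>\<alpha>\<close> of \<open>a\<close> satisfy the Gronwall inequality.\<close>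

lemma Volterra_equation_unique:
  assumes a: "ktri a = a" and e: "ktri e = 0" and ae: "ktri (e + kcomp a e) = e + kcomp a e"
  shows "e = 0"
proof -
  define k h where "k = rep_L2 a" and "h = rep_L2 e"
  have k: "sq_integrable k" and h: "sq_integrable h"
    by (simp_all add: k_def h_def sq_integrable_rep)
  have kh: "a = abs_L2 k" "e = abs_L2 h" by (simp_all add: k_def h_def abs_rep_L2)
  have [measurable]: "k \<in> borel_measurable borel" "h \<in> borel_measurable borel"
    using k h by (simp_all add: sq_integrable_def)
  have k0: "AE p in lborel. snd p > fst p \<longrightarrow> k p = 0"
    using a by (simp add: kh ktri_eq_iff k)
  have h0: "AE p in lborel. snd p \<le> fst p \<longrightarrow> h p = 0"
  proof -
    have "abs_L2 (\<lambda>p. if snd p \<le> fst p then h p else 0) = abs_L2 (\<lambda>p. 0)"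
      using e h by (simp add: kh ktri.abs_eq L2_rel_def zero_L2_def)
    then have "AE p in lborel. (if snd p \<le> fst p then h p else 0) = 0"
      by (simp add: abs_L2_eq_iff sq_integrable_if h lower_triangle_borel sq_integrable_zero)
    then show ?thesis by eventually_elim auto
  qed
  have kh0: "AE p in lborel. snd p > fst p \<longrightarrow> h p + kernel_comp k h p = 0"
  proof -
    have "e + kcomp a e = abs_L2 (\<lambda>p. h p + kernel_comp k h p)"
      using k h by (simp add: kh kcomp.abs_eq plus_L2.abs_eq L2_rel_def kernel_comp_sq_integrable)
    with ae show ?thesis
      by (simp add: ktri_eq_iff sq_integrable_add kernel_comp_sq_integrable k h)
  qed
  define \<epsilon> where "\<epsilon> x = (LINT z|lborel. (h (x, z))\<^sup>2)" for x
  define \<alpha> where "\<alpha> x = (LINT y|lborel. (k (x, y))\<^sup>2)" for x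
  have "AE x in lborel. \<epsilon> x = 0"
  proof (rule Gronwall_zero)
    show "integrable lborel \<alpha>" "integrable lborel \<epsilon>"
      unfolding \<alpha>_def \<epsilon>_def by (intro row_norms k h)+
    show "0 \<le> \<alpha> x" "0 \<le> \<epsilon> x" for x by (simp_all add: \<alpha>_def \<epsilon>_def)
    show "AE x in lborel. \<epsilon> x \<le> \<alpha> x * (LINT y|lborel. indicator {..x} y * \<epsilon> y)"
      using sq_integrable_row[OF k] AE_lborel_sections[OF k0] AE_lborel_sections[OF h0]
        AE_lborel_sections[OF kh0]
    proof eventually_elim
      case (elim x)
      define h' where "h' p = (if snd p \<le> x then h (snd p, fst p) else 0)" for p
      have "{p :: real \<times> real. snd p \<le> x} \<in> sets borel"
        by (intro borel_closed closed_Collect_le continuous_intros)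
      then have h': "sq_integrable h'"
        unfolding h'_def[abs_def] by (intro sq_integrable_if sq_integrable_swap h)
      have [measurable]: "h' \<in> borel_measurable borel"
        using h' by (simp add: sq_integrable_def)
      have *: "kernel_comp k h (x, z) = kernel_apply h' (\<lambda>y. k (x, y)) z" for z
        unfolding kernel_comp_def kernel_apply_def fst_conv snd_conv
      proof (rule integral_cong_AE)
        show "AE y in lborel. k (x, y) * h (y, z) = h' (z, y) * k (x, y)"
          using elim(2) by eventually_elim (auto simp: h'_def)
      qed measurable
      have "\<epsilon> x \<le> (LINT z|lborel. (kernel_apply h' (\<lambda>y. k (x, y)) z)\<^sup>2)"
        unfolding \<epsilon>_def
      proof (rule sq_integrable_dominated(2))
        show "(\<lambda>z. h (x, z)) \<in> borel_measurable lborel" by measurable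
        show "integrable lborel (\<lambda>z. (kernel_apply h' (\<lambda>y. k (x, y)) z)\<^sup>2)"
          using kernel_apply_sq_integrable(1)[OF h' elim(1)] by (simp add: sq_integrable_def)
        show "AE z in lborel. (h (x, z))\<^sup>2 \<le> (kernel_apply h' (\<lambda>y. k (x, y)) z)\<^sup>2"
          using elim(3,4)
        proof eventually_elim
          case (elim z)
          have "h (x, z) = 0 \<or> h (x, z) = - kernel_comp k h (x, z)"
            using elim by (cases "z \<le> x") auto
          then show ?case by (auto simp: *)
        qed
      qed
      also have "\<dots> \<le> (LINT p|lborel. (h' p)\<^sup>2) * \<alpha> x"
        unfolding \<alpha>_def by (rule kernel_apply_sq_integrable(2)[OF h' elim(1)])
      also have "(LINT p|lborel. (h' p)\<^sup>2) = (LINT y|lborel. indicator {..x} y * \<epsilon> y)"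
        unfolding column_norms(2)[OF h', symmetric]
        by (intro Bochner_Integration.integral_cong) (auto simp: h'_def \<epsilon>_def indicator_def)
      finally show ?case by (simp add: mult.commute)
    qed
  qed
  then have "(LINT x|lborel. \<epsilon> x) = 0" by (rule integral_eq_zero_AE)
  then have "(LINT p|lborel. (h p)\<^sup>2) = 0"
    unfolding \<epsilon>_def row_norms(2)[OF h] .
  then have "(norm (e - 0))\<^sup>2 = 0"
    unfolding kh using norm_abs_L2_diff[OF h sq_integrable_zero] by (simp add: zero_L2_def)
  then show ?thesis by simp
qed

text \<open>The hypothesis says \<open>(1 + a)(1 + b) = 1\<close>. Because \<open>a\<close> and the lower part of \<open>b\<close> compose to a lower
  kernel, the strictly upper part \<open>e\<close> of \<open>b\<close> satisfies the homogeneous equation of the preceding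
  lemma.\<close>

lemma Volterra_inverse:
  assumes a: "ktri a = a" and ab: "a + b + kcomp a b = 0"
  shows "ktri b = b"
proof -
  define e where "e = b - ktri b"
  have b: "b = ktri b + e" by (simp add: e_def)
  have neg: "ktri (- c) = - ktri c" for c using ktri_linear(2)[of "-1" c] by simp
  have "ktri e = 0"
    using ktri_linear(1)[of b "- ktri b"] by (simp add: e_def neg ktri_ktri)
  moreover have "e + kcomp a e = - (a + ktri b + kcomp a (ktri b))"
  proof -
    have "a + (ktri b + e) + (kcomp a (ktri b) + kcomp a e) = 0"
      using ab b kcomp_linear(2)[of a "ktri b" e] by metis
    then show ?thesis by (simp add: eq_neg_iff_add_eq_0 algebra_simps)
  qed
  then have "ktri (e + kcomp a e) = e + kcomp a e"
    by (simp only: neg ktri_linear a ktri_ktri ktri_kcomp[OF a ktri_ktri])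
  ultimately have "e = 0" using Volterra_equation_unique[OF a] by blast
  with b show ?thesis by simp
qed

section \<open>The unital Banach algebra of Hilbert-Schmidt kernels\<close>

text \<open>The unitization of the algebra of kernels: \<open>Unitize r k\<close> stands for \<open>r I\<close> plus the integral operator
  with kernel \<open>k\<close>. It brings the elements of \<open>I + \<gg>\<close> and of \<open>\<gg>\<close> into one Banach algebra whose topology
  on kernels is that of the Hilbert-Schmidt norm.\<close>

datatype hs_unitization = Unitize (scalar_part: real) (kernel_part: L2_kernel)

instantiation hs_unitization :: real_normed_algebra_1
begin

definition "0 = Unitize 0 0"
definition "1 = Unitize 1 0"
definition "a + b = Unitize (scalar_part a + scalar_part b) (kernel_part a + kernel_part b)"
definition "a - b = Unitize (scalar_part a - scalar_part b) (kernel_part a - kernel_part b)"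
definition "- a = Unitize (- scalar_part a) (- kernel_part a)"
definition "r *\<^sub>R a = Unitize (r * scalar_part a) (r *\<^sub>R kernel_part a)"
definition "a * b = Unitize (scalar_part a * scalar_part b)
  (scalar_part a *\<^sub>R kernel_part b + scalar_part b *\<^sub>R kernel_part a
    + kcomp (kernel_part a) (kernel_part b))"
definition "norm a = \<bar>scalar_part a\<bar> + norm (kernel_part a)"
definition "dist a b = norm (a - b :: hs_unitization)"
definition "sgn a = inverse (norm a) *\<^sub>R (a :: hs_unitization)"
definition "uniformity = (INF e\<in>{0<..}. principal {(a, b :: hs_unitization). dist a b < e})"
definition "open U = (\<forall>a\<in>U. \<forall>\<^sub>F (a', b) in uniformity. a' = a \<longrightarrow> (b :: hs_unitization) \<in> U)"

lemmas hs_unitization_defs = zero_hs_unitization_def one_hs_unitization_def plus_hs_unitization_def minus_hs_unitization_def uminus_hs_unitization_def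
  scaleR_hs_unitization_def times_hs_unitization_def

instance
proof
  fix a b c :: hs_unitization and r s :: real
  show "a + b + c = a + (b + c)" "a + b = b + a" "0 + a = a" "- a + a = 0" "a - b = a + - b"
    "r *\<^sub>R (a + b) = r *\<^sub>R a + r *\<^sub>R b" "(r + s) *\<^sub>R a = r *\<^sub>R a + s *\<^sub>R a"
    "r *\<^sub>R s *\<^sub>R a = (r * s) *\<^sub>R a" "1 *\<^sub>R a = a" "(0::hs_unitization) \<noteq> 1"
    by (simp_all add: hs_unitization_defs algebra_simps)
  have k0: "kcomp 0 k = 0" "kcomp k 0 = 0" for k
    using kcomp_linear(3)[of 0 0 k] kcomp_linear(4)[of k 0 0] by simp_all
  show "1 * a = a" "a * 1 = a"
    by (simp_all add: hs_unitization_defs k0)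
  show "a * b * c = a * (b * c)" "(a + b) * c = a * c + b * c" "a * (b + c) = a * b + a * c"
    "r *\<^sub>R a * b = r *\<^sub>R (a * b)" "a * r *\<^sub>R b = r *\<^sub>R (a * b)"
    by (simp_all add: hs_unitization_defs kcomp_linear kcomp_assoc algebra_simps)
  show "dist a b = norm (a - b)" by (rule dist_hs_unitization_def)
  show "sgn a = inverse (norm a) *\<^sub>R a" by (rule sgn_hs_unitization_def)
  show "uniformity = (INF e\<in>{0<..}. principal {(a, b :: hs_unitization). dist a b < e})"
    by (rule uniformity_hs_unitization_def)
  show "open U = (\<forall>a\<in>U. \<forall>\<^sub>F (a', b) in uniformity. a' = a \<longrightarrow> b \<in> U)" for U :: "hs_unitization set"
    by (rule open_hs_unitization_def)
  show "norm a = 0 \<longleftrightarrow> a = 0"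
    by (cases a) (auto simp: norm_hs_unitization_def hs_unitization_defs add_nonneg_eq_0_iff)
  show "norm (a + b) \<le> norm a + norm b"
    using norm_triangle_ineq[of "kernel_part a" "kernel_part b"] abs_triangle_ineq[of "scalar_part a" "scalar_part b"]
    by (simp add: norm_hs_unitization_def plus_hs_unitization_def)
  show "norm (r *\<^sub>R a) = \<bar>r\<bar> * norm a"
    by (simp add: norm_hs_unitization_def scaleR_hs_unitization_def abs_mult distrib_left)
  show "norm (a * b) \<le> norm a * norm b"
  proof -
    have "norm (scalar_part a *\<^sub>R kernel_part b + scalar_part b *\<^sub>R kernel_part a
          + kcomp (kernel_part a) (kernel_part b))
        \<le> \<bar>scalar_part a\<bar> * norm (kernel_part b) + \<bar>scalar_part b\<bar> * norm (kernel_part a)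
          + norm (kernel_part a) * norm (kernel_part b)"
      by (intro norm_triangle_mono) (simp_all add: norm_kcomp_le)
    then show ?thesis
      by (simp add: norm_hs_unitization_def times_hs_unitization_def abs_mult algebra_simps)
  qed
  show "norm (1 :: hs_unitization) = 1" by (simp add: norm_hs_unitization_def one_hs_unitization_def)
qed

end

lemma scalar_part_simps [simp]:
  "scalar_part 0 = 0" "scalar_part 1 = 1" "scalar_part (a + b) = scalar_part a + scalar_part b"
  "scalar_part (a - b) = scalar_part a - scalar_part b" "scalar_part (- a) = - scalar_part a"
  "scalar_part (r *\<^sub>R a) = r * scalar_part a" "scalar_part (a * b) = scalar_part a * scalar_part b"
  by (simp_all add: hs_unitization_defs)

lemma kernel_part_simps [simp]:
  "kernel_part 0 = 0" "kernel_part 1 = 0" "kernel_part (a + b) = kernel_part a + kernel_part b"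
  "kernel_part (a - b) = kernel_part a - kernel_part b" "kernel_part (- a) = - kernel_part a"
  "kernel_part (r *\<^sub>R a) = r *\<^sub>R kernel_part a"
  by (simp_all add: hs_unitization_defs)

lemma norm_parts_le: "\<bar>scalar_part a\<bar> \<le> norm a" "norm (kernel_part a) \<le> norm a"
  by (simp_all add: norm_hs_unitization_def)

lemma bounded_linear_scalar_part: "bounded_linear scalar_part"
  by (rule bounded_linear_intro[where K = 1]) (simp_all add: norm_parts_le)

lemma bounded_linear_kernel_part: "bounded_linear kernel_part"
  by (rule bounded_linear_intro[where K = 1]) (simp_all add: norm_parts_le)

instance hs_unitization :: banach
proof
  fix X :: "nat \<Rightarrow> hs_unitization"
  assume X: "Cauchy X"
  have "Cauchy (\<lambda>n. scalar_part (X n))"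
    by (rule bounded_linear.Cauchy[OF bounded_linear_scalar_part X])
  then obtain r where r: "(\<lambda>n. scalar_part (X n)) \<longlonglongrightarrow> r"
    using Cauchy_convergent convergent_def by blast
  have "Cauchy (\<lambda>n. kernel_part (X n))"
    by (rule bounded_linear.Cauchy[OF bounded_linear_kernel_part X])
  then obtain k where k: "(\<lambda>n. kernel_part (X n)) \<longlonglongrightarrow> k"
    using Cauchy_convergent convergent_def by blast
  have "(\<lambda>n. \<bar>scalar_part (X n) - r\<bar> + norm (kernel_part (X n) - k)) \<longlonglongrightarrow> \<bar>r - r\<bar> + norm (k - k)"
    by (intro tendsto_intros r k)
  then have "(\<lambda>n. norm (X n - Unitize r k)) \<longlonglongrightarrow> 0"
    by (simp add: norm_hs_unitization_def minus_hs_unitization_def)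
  then have "X \<longlonglongrightarrow> Unitize r k"
    by (simp add: tendsto_norm_zero_iff LIM_zero_iff)
  then show "convergent X" by (auto simp: convergent_def)
qed

definition star :: "hs_unitization \<Rightarrow> hs_unitization" where "star a = Unitize (scalar_part a) (ktrans (kernel_part a))"

text \<open>On elements with scalar part zero this is the truncation to Volterra kernels. The scalar part is
  sent to zero, so that \<open>Tri a = a\<close> characterizes the elements of \<open>\<ll>\<close>.\<close>

definition Tri :: "hs_unitization \<Rightarrow> hs_unitization" where "Tri a = Unitize 0 (ktri (kernel_part a))"

lemma scalar_part_star_Tri [simp]: "scalar_part (star a) = scalar_part a" "scalar_part (Tri a) = 0"
  by (simp_all add: star_def Tri_def)

lemma bounded_linear_star: "bounded_linear star"
  by (rule bounded_linear_intro[where K = 1])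
    (simp_all add: star_def ktrans_linear norm_hs_unitization_def norm_ktrans plus_hs_unitization_def scaleR_hs_unitization_def)

lemma norm_Tri_le: "norm (Tri a) \<le> norm a"
  using norm_ktri_le[of "kernel_part a"] by (simp add: Tri_def norm_hs_unitization_def)

lemma bounded_linear_Tri: "bounded_linear Tri"
  by (rule bounded_linear_intro[where K = 1])
    (simp_all add: norm_Tri_le, simp_all add: Tri_def ktri_linear plus_hs_unitization_def scaleR_hs_unitization_def)

lemma star_linear: "star (a + b) = star a + star b" "star (a - b) = star a - star b"
  "star (r *\<^sub>R a) = r *\<^sub>R star a" "star (- a) = - star a" "star 0 = 0"
  using bounded_linear_star
  by (simp_all add: bounded_linear.linear linear_add linear_scale linear_0 linear_neg linear_diff)

lemma Tri_linear: "Tri (a + b) = Tri a + Tri b" "Tri (a - b) = Tri a - Tri b"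
  "Tri (r *\<^sub>R a) = r *\<^sub>R Tri a" "Tri (- a) = - Tri a" "Tri 0 = 0"
  using bounded_linear_Tri
  by (simp_all add: bounded_linear.linear linear_add linear_scale linear_0 linear_neg linear_diff)

lemma star_star [simp]: "star (star a) = a"
  by (simp add: star_def ktrans_ktrans)

lemma star_mult: "star (a * b) = star b * star a"
  by (simp add: star_def times_hs_unitization_def ktrans_linear ktrans_kcomp mult.commute add.commute)

lemma star_one [simp]: "star 1 = 1"
  using ktrans_linear(2)[of 0 0] by (simp add: star_def one_hs_unitization_def)

lemma Tri_Tri [simp]: "Tri (Tri a) = Tri a"
  by (simp add: Tri_def ktri_ktri)

lemma Tri_split: "scalar_part a = 0 \<Longrightarrow> Tri a + star (Tri (star a)) = a"
  by (cases a) (simp add: Tri_def star_def plus_hs_unitization_def ktri_split)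

text \<open>The adjoint of a Volterra kernel lives above the diagonal.\<close>

lemma Tri_star_Tri: "Tri (star (Tri a)) = 0"
proof -
  have "star (Tri (star (Tri a))) = 0"
    using Tri_split[of "Tri a"] by simp
  then have "star (star (Tri (star (Tri a)))) = star 0" by simp
  then show ?thesis by (simp only: star_star star_linear)
qed

lemma Tri_mult: "Tri a = a \<Longrightarrow> Tri b = b \<Longrightarrow> Tri (a * b) = a * b"
  by (cases a, cases b) (auto simp: Tri_def times_hs_unitization_def ktri_kcomp)

text \<open>The elements \<open>x\<close> with \<open>Tri (x - 1) = x - 1\<close> form the group \<open>I + \<ll>\<close>. This lemma and the next provide
  its closure properties.\<close>

lemma unilower_mult:
  assumes "Tri (a - 1) = a - 1" "Tri (b - 1) = b - 1"
  shows "Tri (a * b - 1) = a * b - 1"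
proof -
  have "a * b - 1 = (a - 1) * (b - 1) + (a - 1) + (b - 1)" by (simp add: algebra_simps)
  then show ?thesis by (simp only: Tri_linear(1) Tri_mult[OF assms] assms)
qed

lemma unilower_inverse:
  assumes a: "Tri (a - 1) = a - 1" and ab: "a * b = 1"
  shows "Tri (b - 1) = b - 1"
proof -
  have s: "scalar_part a = 1"
    using arg_cong[OF a, of scalar_part] by simp
  then have "scalar_part b = 1"
    using arg_cong[OF ab, of scalar_part] by simp
  with s ab have "kernel_part a + kernel_part b + kcomp (kernel_part a) (kernel_part b) = 0"
    by (simp add: times_hs_unitization_def one_hs_unitization_def add.commute)
  moreover have "ktri (kernel_part a) = kernel_part a"
    using arg_cong[OF a, of kernel_part] by (simp add: Tri_def)
  ultimately have "ktri (kernel_part b) = kernel_part b"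
    using Volterra_inverse by blast
  with \<open>scalar_part b = 1\<close> show ?thesis
    by (simp add: Tri_def minus_hs_unitization_def one_hs_unitization_def)
qed

section \<open>Differentiability of the factors\<close>

text \<open>The second factor vanishes at \<open>t\<close>, so the difference quotient of the product is \<open>f\<close> times that of
  \<open>g\<close>: a null function times a bounded one. The product rule does not apply, as \<open>f\<close> is merely
  known to tend to zero at \<open>t\<close>.\<close>

lemma has_vector_derivative_mult_zero:
  fixes f g :: "real \<Rightarrow> 'a::real_normed_algebra"
  assumes f: "(f \<longlongrightarrow> 0) (at t)" and g: "(g has_vector_derivative g') (at t)" "g t = 0"
  shows "((\<lambda>s. f s * g s) has_vector_derivative 0) (at t)"
proof -
  define q where "q s = (g s - g t - (s - t) *\<^sub>R g') /\<^sub>R norm (s - t)" for s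
  have q: "(q \<longlongrightarrow> 0) (at t)"
    using g(1) unfolding has_vector_derivative_def has_derivative_at_within q_def by simp
  have "((\<lambda>s. (f s * g s) /\<^sub>R norm (s - t)) \<longlongrightarrow> 0) (at t)"
  proof (rule Lim_null_comparison)
    have "norm ((f s * g s) /\<^sub>R norm (s - t)) \<le> norm (f s) * (norm (q s) + norm g')" if "s \<noteq> t" for s
    proof -
      have "g s /\<^sub>R norm (s - t) = q s + ((s - t) / norm (s - t)) *\<^sub>R g'"
        by (simp add: q_def g(2) scaleR_diff_right divide_inverse)
      moreover have "norm (((s - t) / norm (s - t)) *\<^sub>R g') = norm g'" using that by simp
      ultimately have "norm (g s /\<^sub>R norm (s - t)) \<le> norm (q s) + norm g'"
        by (metis norm_triangle_ineq)
      then have "norm (f s) * norm (g s /\<^sub>R norm (s - t)) \<le> norm (f s) * (norm (q s) + norm g')"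
        by (intro mult_left_mono) auto
      then show ?thesis
        using norm_mult_ineq[of "f s" "g s /\<^sub>R norm (s - t)"] by (simp only: mult_scaleR_right)
    qed
    then show "\<forall>\<^sub>F s in at t. norm ((f s * g s) /\<^sub>R norm (s - t)) \<le> norm (f s) * (norm (q s) + norm g')"
      by (auto simp: eventually_at_filter)
    show "((\<lambda>s. norm (f s) * (norm (q s) + norm g')) \<longlongrightarrow> 0) (at t)"
      using tendsto_mult[OF tendsto_norm[OF f] tendsto_add[OF tendsto_norm[OF q] tendsto_const[of "norm g'"]]]
      by simp
  qed
  then show ?thesis
    by (simp add: has_vector_derivative_def has_derivative_at_within g(2))
qed

text \<open>The equation alone makes \<open>b\<close> differentiable. Truncation is a contraction, so \<open>\<parallel>b\<parallel> \<le> \<parallel>S\<parallel> + \<parallel>b\<parallel> \<parallel>S\<parallel>\<close>, and where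
  \<open>\<parallel>S\<parallel> < 1/2\<close> this gives \<open>\<parallel>b\<parallel> \<le> 2 \<parallel>S\<parallel>\<close>. Thus \<open>b\<close> tends to zero at \<open>t\<close> and the term \<open>b S\<close> is of
  higher order.\<close>

lemma Tri_equation_derivative:
  fixes b S :: "real \<Rightarrow> hs_unitization"
  assumes S: "(S has_vector_derivative S') (at t)" "S t = 0"
    and b: "\<And>s. b s = - Tri (S s) - Tri (b s * S s)"
  shows "(b has_vector_derivative - Tri S') (at t)"
proof -
  have "(S \<longlongrightarrow> S t) (at t)"
    using has_vector_derivative_continuous[OF S(1)] by (simp add: continuous_at isCont_def continuous_within)
  then have S0: "((\<lambda>s. norm (S s)) \<longlongrightarrow> 0) (at t)" using S(2) by (simp add: tendsto_norm_zero)
  have bound: "norm (b s) \<le> 2 * norm (S s)" if "norm (S s) < 1/2" for s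
  proof -
    have "norm (b s) \<le> norm (Tri (S s)) + norm (Tri (b s * S s))"
      by (subst b) (metis norm_triangle_ineq4 norm_minus_cancel)
    also have "\<dots> \<le> norm (S s) + norm (b s) * norm (S s)"
      by (intro add_mono norm_Tri_le order.trans[OF norm_Tri_le norm_mult_ineq])
    also have "norm (b s) * norm (S s) \<le> norm (b s) * (1/2)"
      using that by (intro mult_left_mono) auto
    finally show ?thesis by simp
  qed
  have b0: "(b \<longlongrightarrow> 0) (at t)"
  proof (rule Lim_null_comparison)
    have "\<forall>\<^sub>F s in at t. norm (S s) < 1/2" using S0 by (rule order_tendstoD) simp
    then show "\<forall>\<^sub>F s in at t. norm (b s) \<le> 2 * norm (S s)" by eventually_elim (rule bound)
    show "((\<lambda>s. 2 * norm (S s)) \<longlongrightarrow> 0) (at t)" using tendsto_mult_left[OF S0, of 2] by simp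
  qed
  have "((\<lambda>s. - Tri (S s) - Tri (b s * S s)) has_vector_derivative - Tri S' - Tri 0) (at t)"
    by (intro derivative_intros bounded_linear.has_vector_derivative[OF bounded_linear_Tri] S(1)
        has_vector_derivative_mult_zero[OF b0 S])
  then show ?thesis unfolding b[symmetric] by (simp add: Tri_linear)
qed


lemma lower_factor_inverse:
  assumes "u * v = 1" "v * u = 1" "p * star p = 1" "star p * p = 1"
  shows "(u * p) * (star p * v) = 1" "(star p * v) * (u * p) = 1"
proof -
  have "(u * p) * (star p * v) = u * (p * star p) * v" by (simp only: mult.assoc)
  then show "(u * p) * (star p * v) = 1" by (simp add: assms)
  have "(star p * v) * (u * p) = star p * (v * u) * p" by (simp only: mult.assoc)
  then show "(star p * v) * (u * p) = 1" by (simp add: assms)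
qed

lemma exp_scaleR_inverse:
  fixes c :: hs_unitization
  shows "exp (s *\<^sub>R c) * exp (- (s *\<^sub>R c)) = 1" "exp (- (s *\<^sub>R c)) * exp (s *\<^sub>R c) = 1"
  using exp_minus_inverse[of "s *\<^sub>R c"] exp_minus_inverse[of "- (s *\<^sub>R c)"] by simp_all

text \<open>The isospectral flow inside the Banach algebra, with \<open>n\<close> the inverse of the lower factor \<open>m\<close>. With
  \<open>L = Tri (K + star K)\<close>, the Volterra part of \<open>K\<close>, the derivatives at \<open>t\<close> of \<open>b = n s m t - 1\<close>
  and \<open>a = n t m s - 1\<close> turn out to be \<open>L / 2\<close> and \<open>- L / 2\<close>, and
  \<open>K s = (1 + b) (K t) (1 + a)\<close>.\<close>

proposition factorization_flow_derivative:
  fixes m p n K :: "real \<Rightarrow> hs_unitization" and \<kappa> c :: hs_unitization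
  assumes \<kappa>: "scalar_part \<kappa> = 0" and c: "c = - (1/2) *\<^sub>R \<kappa>"
    and m: "\<And>s. Tri (m s - 1) = m s - 1"
    and p: "\<And>s. p s * star (p s) = 1" "\<And>s. star (p s) * p s = 1"
    and fact: "\<And>s. exp (s *\<^sub>R c) * p s = m s"
    and n: "\<And>s. n s = star (p s) * exp (- (s *\<^sub>R c))"
    and K: "\<And>s. K s = n s * \<kappa> * m s"
  shows "K s = star (p s) * \<kappa> * p s"
    and "(K has_vector_derivative
      (1/2) *\<^sub>R (Tri (K t + star (K t)) * K t - K t * Tri (K t + star (K t)))) (at t)"
    and "m 0 = 1" and "n 0 = 1"
proof -
  have \<kappa>_c: "\<kappa> = - 2 *\<^sub>R c" by (simp add: c)
  note exp_inv = exp_scaleR_inverse[of _ c]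
  have mn: "m s * n s = 1" "n s * m s = 1" for s
    unfolding fact[symmetric] n by (intro lower_factor_inverse exp_inv p)+
  have conj: "K s = star (p s) * \<kappa> * p s" for s
  proof -
    have "K s = star (p s) * (exp (- (s *\<^sub>R c)) * (\<kappa> * exp (s *\<^sub>R c))) * p s"
      unfolding K n fact[symmetric] by (simp only: mult.assoc)
    also have "\<kappa> * exp (s *\<^sub>R c) = exp (s *\<^sub>R c) * \<kappa>"
      by (simp add: \<kappa>_c exp_times_scaleR_commute)
    finally show ?thesis by (simp add: exp_inv flip: mult.assoc[of "exp (- (s *\<^sub>R c))"])
  qed
  then show "K s = star (p s) * \<kappa> * p s" .
  have n_lower: "Tri (n s - 1) = n s - 1" for s
    by (rule unilower_inverse[OF m mn(1)])
  \<comment> \<open>\<open>m 0\<close> is orthogonal, so its inverse is its adjoint; an element that is both lower and strictly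
    upper vanishes.\<close>
  show "m 0 = 1"
  proof -
    have "p 0 = m 0" using fact[of 0] by simp
    then have "n 0 = star (m 0)" using n[of 0] by simp
    then have "n 0 - 1 = star (Tri (m 0 - 1))" using m[of 0] by (simp add: star_linear)
    then have "n 0 - 1 = 0" using n_lower[of 0] Tri_star_Tri[of "m 0 - 1"] by metis
    then show ?thesis using mn(1)[of 0] by simp
  qed
  with mn(1)[of 0] show "n 0 = 1" by simp
  define E S a b where "E s = exp (- (t *\<^sub>R c)) * exp (s *\<^sub>R c)"
    and "S s = star (p t) * (E s * star (E s)) * p t - 1"
    and "a s = n t * m s - 1" and "b s = n s * m t - 1" for s
  have E_t: "E t = 1" by (simp add: E_def exp_inv)
  have S_t: "S t = 0" by (simp add: S_def E_t p)
  have "(E has_vector_derivative exp (- (t *\<^sub>R c)) * (exp (t *\<^sub>R c) * c)) (at t)"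
    unfolding E_def
    by (intro has_vector_derivative_mult_right exp_scaleR_has_vector_derivative_right)
  then have E': "(E has_vector_derivative c) (at t)"
    by (simp add: exp_inv flip: mult.assoc)
  have "((\<lambda>s. E s * star (E s)) has_vector_derivative E t * star c + c * star (E t)) (at t)"
    by (intro has_vector_derivative_mult E' bounded_linear.has_vector_derivative[OF bounded_linear_star])
  then have EE': "((\<lambda>s. E s * star (E s)) has_vector_derivative c + star c) (at t)"
    by (simp add: E_t add.commute)
  have "(S has_vector_derivative star (p t) * (c + star c) * p t - 0) (at t)"
    unfolding S_def
    by (intro has_vector_derivative_diff has_vector_derivative_mult_left has_vector_derivative_mult_right
        EE' has_vector_derivative_const)
  moreover have "star (p t) * (c + star c) * p t = - (1/2) *\<^sub>R (K t + star (K t))"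
    by (simp add: conj c star_linear star_mult algebra_simps)
  ultimately have S': "(S has_vector_derivative - (1/2) *\<^sub>R (K t + star (K t))) (at t)" by simp
  have ab: "(b s + 1) * (a s + 1) = 1" for s
  proof -
    have "(b s + 1) * (a s + 1) = n s * (m t * n t) * m s"
      by (simp add: a_def b_def mult.assoc)
    then show ?thesis by (simp add: mn)
  qed
  have a_E: "a s + 1 = star (p t) * E s * p s" for s
    unfolding a_def n fact[symmetric] E_def by (simp add: mult.assoc)
  \<comment> \<open>Orthogonality of \<open>p s\<close> removes the uncontrolled factor.\<close>
  have SS: "(a s + 1) * star (a s + 1) = S s + 1" for s
  proof -
    have "(a s + 1) * star (a s + 1) = star (p t) * E s * (p s * star (p s)) * star (E s) * p t"
      unfolding a_E star_mult star_star by (simp only: mult.assoc)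
    then show ?thesis by (simp add: p S_def mult.assoc)
  qed
  have star_a: "star (a s) = b s + S s + b s * S s" for s
  proof -
    have "star (a s + 1) = (b s + 1) * ((a s + 1) * star (a s + 1))"
      by (simp only: ab mult_1_left flip: mult.assoc)
    then show ?thesis unfolding SS by (simp add: star_linear algebra_simps)
  qed
  have a_lower: "Tri (a s) = a s" and b_lower: "Tri (b s) = b s" for s
    unfolding a_def b_def by (intro unilower_mult n_lower m)+
  have b_eq: "b s = - Tri (S s) - Tri (b s * S s)" for s
  proof -
    have "0 = Tri (star (a s))" using Tri_star_Tri[of "a s"] a_lower[of s] by simp
    also have "\<dots> = b s + Tri (S s) + Tri (b s * S s)"
      unfolding star_a Tri_linear b_lower ..
    finally show ?thesis by (simp add: algebra_simps eq_neg_iff_add_eq_0)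
  qed
  define L where "L = Tri (K t + star (K t))"
  have scalar_K: "scalar_part (K t) = 0" by (simp add: K \<kappa>)
  have L_split: "L + star L = K t + star (K t)"
    using Tri_split[of "K t + star (K t)"] scalar_K by (simp add: L_def star_linear add.commute)
  have "(b has_vector_derivative - Tri (- (1/2) *\<^sub>R (K t + star (K t)))) (at t)"
    by (rule Tri_equation_derivative[OF S' S_t b_eq])
  then have b': "(b has_vector_derivative (1/2) *\<^sub>R L) (at t)"
    by (simp add: Tri_linear L_def)
  have b_t: "b t = 0" and a_t: "a t = 0" by (simp_all add: a_def b_def mn)
  have "((\<lambda>s. b s + S s + b s * S s) has_vector_derivative
      (1/2) *\<^sub>R L + (- (1/2) *\<^sub>R (K t + star (K t))) + (b t * (- (1/2) *\<^sub>R (K t + star (K t))) + (1/2) *\<^sub>R L * S t)) (at t)"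
    by (intro has_vector_derivative_add has_vector_derivative_mult b' S')
  moreover have "(1/2) *\<^sub>R L + (- (1/2) *\<^sub>R (K t + star (K t))) = - (1/2) *\<^sub>R star L"
    unfolding L_split[symmetric] by (simp add: algebra_simps)
  ultimately have "((\<lambda>s. star (a s)) has_vector_derivative - (1/2) *\<^sub>R star L) (at t)"
    by (simp add: star_a b_t S_t)
  from bounded_linear.has_vector_derivative[OF bounded_linear_star this]
  have a': "(a has_vector_derivative - (1/2) *\<^sub>R L) (at t)" by (simp add: star_linear)
  have K_ab: "K s = (b s + 1) * K t * (a s + 1)" for s
  proof -
    have "(b s + 1) * K t * (a s + 1) = n s * (m t * n t) * \<kappa> * (m t * n t) * m s"
      by (simp add: a_def b_def K mult.assoc)
    then show ?thesis by (simp add: mn K)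
  qed
  have "((\<lambda>s. (b s + 1) * K t * (a s + 1)) has_vector_derivative
      (b t + 1) * K t * (- (1/2) *\<^sub>R L + 0) + ((1/2) *\<^sub>R L + 0) * K t * (a t + 1)) (at t)"
    by (intro has_vector_derivative_mult has_vector_derivative_mult_left has_vector_derivative_add
        has_vector_derivative_const a' b')
  then have "(K has_vector_derivative (b t + 1) * K t * (- (1/2) *\<^sub>R L + 0) + ((1/2) *\<^sub>R L + 0) * K t * (a t + 1)) (at t)"
    unfolding K_ab[symmetric] .
  then show "(K has_vector_derivative
      (1/2) *\<^sub>R (Tri (K t + star (K t)) * K t - K t * Tri (K t + star (K t)))) (at t)"
    by (simp add: a_t b_t algebra_simps flip: L_def)
qed

section \<open>From kernels to operators\<close>

definition to_op :: "hs_unitization \<Rightarrow> operator" where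
  "to_op a = scalar_part a *\<^sub>R id_blinfun + Op (kernel_part a)"

lemma bounded_linear_to_op: "bounded_linear to_op"
  using bounded_linear_add[OF bounded_linear_scaleR_const[OF bounded_linear_scalar_part]
      bounded_linear_compose[OF bounded_linear_Op bounded_linear_kernel_part]]
  unfolding to_op_def[abs_def] .

lemma to_op_linear: "to_op (a + b) = to_op a + to_op b" "to_op (a - b) = to_op a - to_op b"
  "to_op (r *\<^sub>R a) = r *\<^sub>R to_op a" "to_op (- a) = - to_op a" "to_op 0 = 0"
  using bounded_linear_to_op
  by (simp_all add: bounded_linear.linear linear_add linear_scale linear_0 linear_neg linear_diff)

lemma to_op_one [simp]: "to_op 1 = id_blinfun"
  by (simp add: to_op_def Op_linear)

lemma to_op_mult: "to_op (a * b) = to_op a o\<^sub>L to_op b"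
  by (rule blinfun_eqI)
    (simp add: to_op_def times_hs_unitization_def Op_linear Op_kcomp blinfun.add_left blinfun.add_right
      blinfun.scaleR_left blinfun.scaleR_right algebra_simps)

text \<open>For equal scalar parts this is the uniqueness of kernels.\<close>

lemma to_op_cancel: "to_op a = to_op b \<Longrightarrow> scalar_part a = scalar_part b \<Longrightarrow> a = b"
  by (cases a, cases b) (simp add: to_op_def)

lemma adj_to_op: "adj_op (to_op a) = to_op (star a)"
proof -
  have "adjoint (blinfun_apply (to_op a)) = blinfun_apply (to_op (star a))"
  proof (rule adjoint_unique, intro allI)
    fix f g
    have "kapply (kernel_part a) f \<bullet> g = f \<bullet> kapply (ktrans (kernel_part a)) g"
      using kapply_ktrans[of "ktrans (kernel_part a)" f g] by (simp add: ktrans_ktrans)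
    then show "to_op a f \<bullet> g = f \<bullet> to_op (star a) g"
      by (simp add: to_op_def star_def blinfun.add_left blinfun.scaleR_left inner_add_left inner_add_right)
  qed
  then show ?thesis by (simp add: adj_op_def blinfun_apply_inverse)
qed

lemma scalar_part_exp: "scalar_part (exp a) = exp (scalar_part a)"
proof -
  from bounded_linear.sums[OF bounded_linear_scalar_part exp_converges[of a]]
  have "(\<lambda>n. scalar_part (a ^ n) /\<^sub>R fact n) sums scalar_part (exp a)" by simp
  moreover have "scalar_part (a ^ n) = scalar_part a ^ n" for n
    by (induction n) simp_all
  ultimately show ?thesis
    using exp_converges[of "scalar_part a"] sums_unique2 by fastforce
qed

lemma exp_to_op: "exp_op (to_op a) = to_op (exp a)"
proof -
  have pow: "((o\<^sub>L) (to_op a) ^^ n) id_blinfun = to_op (a ^ n)" for n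
    by (induction n) (simp_all add: to_op_mult)
  have "(\<lambda>n. to_op (a ^ n) /\<^sub>R fact n) sums to_op (exp a)"
    using bounded_linear.sums[OF bounded_linear_to_op exp_converges[of a]] by (simp add: to_op_linear)
  then show ?thesis by (simp add: exp_op_def pow sums_iff)
qed

lemma inv_to_op:
  assumes "a * b = 1" "b * a = 1"
  shows "inv_op (to_op a) = to_op b"
  unfolding inv_op_def
proof (rule the_equality)
  show *: "to_op a o\<^sub>L to_op b = id_blinfun \<and> to_op b o\<^sub>L to_op a = id_blinfun"
    using assms by (simp flip: to_op_mult)
  fix B assume B: "to_op a o\<^sub>L B = id_blinfun \<and> B o\<^sub>L to_op a = id_blinfun"
  have "B = id_blinfun o\<^sub>L B" by (rule blinfun_eqI) simp
  also have "\<dots> = (to_op b o\<^sub>L to_op a) o\<^sub>L B" using * by simp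
  also have "\<dots> = to_op b o\<^sub>L (to_op a o\<^sub>L B)" by (rule blinfun_eqI) simp
  also have "\<dots> = to_op b o\<^sub>L id_blinfun" using B by simp
  also have "\<dots> = to_op b" by (rule blinfun_eqI) simp
  finally show "B = to_op b" .
qed

lemma has_kernel_iff: "has_kernel A k \<longleftrightarrow> A = Op k"
proof -
  have *: "kapply k f = g \<longleftrightarrow> (AE x in lborel. rep_L2 g x = kernel_apply (rep_L2 k) (rep_L2 f) x)" for f g
  proof -
    have "kapply k f = abs_L2 (kernel_apply (rep_L2 k) (rep_L2 f))"
      by (simp add: kapply_def)
    then have "kapply k f = g \<longleftrightarrow> abs_L2 (rep_L2 g) = abs_L2 (kernel_apply (rep_L2 k) (rep_L2 f))"
      unfolding abs_rep_L2 by metis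
    then show ?thesis
      by (simp only: abs_L2_eq_iff[OF sq_integrable_rep kernel_apply_sq_integrable(1)[OF sq_integrable_rep sq_integrable_rep]])
  qed
  have "A = Op k \<longleftrightarrow> (\<forall>f. kapply k f = A f)"
    by (auto intro!: blinfun_eqI)
  then show ?thesis
    unfolding has_kernel_def kernel_apply_def[symmetric] * by (rule sym)
qed

lemma \<gg>_eq: "\<gg> = range Op"
  by (auto simp: \<gg>_def has_kernel_iff)

lemma kernel_Op [simp]: "kernel (Op k) = k"
  by (simp add: kernel_def has_kernel_iff)

lemma \<ll>_eq: "\<ll> = {Op k | k. ktri k = k}"
proof -
  have "ktri k = k \<longleftrightarrow> (AE (x, y) in lborel. y > x \<longrightarrow> rep_L2 k (x, y) = 0)" for k
    using ktri_eq_iff[OF sq_integrable_rep[of k]] by (simp add: abs_rep_L2 case_prod_unfold)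
  then show ?thesis by (auto simp: \<ll>_def has_kernel_iff)
qed

lemma Op_in_\<ll>_iff: "Op k \<in> \<ll> \<longleftrightarrow> ktri k = k"
  by (auto simp: \<ll>_eq)

lemma to_op_Unitize_0: "to_op (Unitize 0 k) = Op k"
  by (simp add: to_op_def)

lemma Op_in_\<kk>_iff: "Op k \<in> \<kk> \<longleftrightarrow> ktrans k = - k"
  using adj_to_op[of "Unitize 0 k"]
  by (simp add: \<kk>_def \<gg>_eq to_op_Unitize_0 star_def flip: Op_linear)

text \<open>If \<open>k - l\<close> is skew, then \<open>l + l\<^sup>* = k + k\<^sup>*\<close>; truncation to the lower triangle removes \<open>l\<^sup>*\<close> and
  leaves \<open>l\<close>. Conversely, the symmetric \<open>k + k\<^sup>*\<close> is the sum of its lower part and the adjoint of that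
  part.\<close>

lemma Op_in_\<ll>_\<kk>_iff: "Op l \<in> \<ll> \<and> Op k - Op l \<in> \<kk> \<longleftrightarrow> l = ktri (k + ktrans k)"
proof -
  have "Op l \<in> \<ll> \<and> Op k - Op l \<in> \<kk> \<longleftrightarrow> Tri (Unitize 0 l) = Unitize 0 l \<and> star (Unitize 0 (k - l)) = - Unitize 0 (k - l)"
    by (simp add: Op_in_\<ll>_iff Op_in_\<kk>_iff Tri_def star_def uminus_hs_unitization_def flip: Op_linear)
  also have "\<dots> \<longleftrightarrow> Unitize 0 l = Tri (Unitize 0 k + star (Unitize 0 k))"
  proof -
    have kl: "Unitize 0 (k - l) = Unitize 0 k - Unitize 0 l" by (simp add: minus_hs_unitization_def)
    have s: "scalar_part (Unitize 0 k + star (Unitize 0 k)) = 0" by simp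
    show ?thesis
      unfolding kl
    proof (intro iffI conjI; (elim conjE)?)
      assume l: "Tri (Unitize 0 l) = Unitize 0 l" and "star (Unitize 0 k - Unitize 0 l) = - (Unitize 0 k - Unitize 0 l)"
      then have "Unitize 0 l + star (Unitize 0 l) = Unitize 0 k + star (Unitize 0 k)"
        by (simp add: star_linear algebra_simps)
      then have "Tri (Unitize 0 l) + Tri (star (Unitize 0 l)) = Tri (Unitize 0 k + star (Unitize 0 k))"
        by (simp only: flip: Tri_linear(1))
      moreover have "Tri (star (Unitize 0 l)) = 0" using Tri_star_Tri[of "Unitize 0 l"] l by simp
      ultimately show "Unitize 0 l = Tri (Unitize 0 k + star (Unitize 0 k))"
        using l by simp
    next
      assume l: "Unitize 0 l = Tri (Unitize 0 k + star (Unitize 0 k))"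
      then show "Tri (Unitize 0 l) = Unitize 0 l" by simp
      have "Unitize 0 l + star (Unitize 0 l) = Unitize 0 k + star (Unitize 0 k)"
        using Tri_split[OF s] unfolding l by (simp add: star_linear add.commute)
      then show "star (Unitize 0 k - Unitize 0 l) = - (Unitize 0 k - Unitize 0 l)"
        by (simp add: star_linear algebra_simps)
    qed
  qed
  also have "\<dots> \<longleftrightarrow> l = ktri (k + ktrans k)"
    by (simp add: Tri_def star_def plus_hs_unitization_def)
  finally show ?thesis .
qed

lemma proj_Op:
  "proj_\<ll> (Op k) = Op (ktri (k + ktrans k))"
  "proj_\<kk> (Op k) = Op k - Op (ktri (k + ktrans k))"
proof -
  show "proj_\<ll> (Op k) = Op (ktri (k + ktrans k))"
    unfolding proj_\<ll>_def
  proof (rule the_equality)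
    show "Op (ktri (k + ktrans k)) \<in> \<ll> \<and> Op k - Op (ktri (k + ktrans k)) \<in> \<kk>"
      by (simp add: Op_in_\<ll>_\<kk>_iff)
    fix L assume "L \<in> \<ll> \<and> Op k - L \<in> \<kk>"
    moreover from this obtain l where "L = Op l" by (auto simp: \<ll>_eq)
    ultimately show "L = Op (ktri (k + ktrans k))" by (simp add: Op_in_\<ll>_\<kk>_iff)
  qed
  show "proj_\<kk> (Op k) = Op k - Op (ktri (k + ktrans k))"
    unfolding proj_\<kk>_def
  proof (rule the_equality)
    show "Op k - Op (ktri (k + ktrans k)) \<in> \<kk> \<and> Op k - (Op k - Op (ktri (k + ktrans k))) \<in> \<ll>"
      using Op_in_\<ll>_\<kk>_iff[of "ktri (k + ktrans k)" k] by simp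
    fix B assume B: "B \<in> \<kk> \<and> Op k - B \<in> \<ll>"
    then obtain l where l: "Op k - B = Op l" by (auto simp: \<ll>_eq)
    then have "B = Op k - Op l" by (simp add: algebra_simps)
    with B l show "B = Op k - Op (ktri (k + ktrans k))"
      using Op_in_\<ll>_\<kk>_iff[of l k] by simp
  qed
qed

lemma proj_to_op:
  assumes "scalar_part a = 0"
  shows "proj_\<ll> (to_op a) = to_op (Tri (a + star a))"
    and "proj_\<kk> (to_op a) = to_op (a - Tri (a + star a))"
  using assms by (cases a; simp add: to_op_def proj_Op Tri_def star_def Op_linear)+

theorem theorem3p2:
  fixes K0 :: operator and bm bp K :: "real \<Rightarrow> operator"
  assumes "K0 \<in> \<gg>"
    and "\<And>t. bm t \<in> group_L"
    and "\<And>t. bp t \<in> group_K"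
    and "\<And>t. exp_op ((- (1/2) * t) *\<^sub>R K0) = bm t o\<^sub>L inv_op (bp t)"
    and K_def: "\<And>t. K t = inv_op (bm t) o\<^sub>L K0 o\<^sub>L bm t"
  shows "(\<forall>t. inv_op (bm t) o\<^sub>L K0 o\<^sub>L bm t = inv_op (bp t) o\<^sub>L K0 o\<^sub>L bp t)
    \<and> (\<forall>t. has_\<gg>_derivative K ((1/2) *\<^sub>R bracket (proj_\<ll> (K t)) (K t)) t)
    \<and> (\<forall>t. (1/2) *\<^sub>R bracket (proj_\<ll> (K t)) (K t) = (1/2) *\<^sub>R bracket (K t) (proj_\<kk> (K t)))
    \<and> K 0 = K0"
proof -
  obtain \<kappa> where K0: "K0 = to_op \<kappa>" and \<kappa>: "scalar_part \<kappa> = 0"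
  proof -
    from assms(1) obtain k where "K0 = Op k" by (auto simp: \<gg>_eq)
    then show ?thesis using that[of "Unitize 0 k"] by (simp add: to_op_Unitize_0)
  qed
  have "\<exists>x. bm t = to_op x \<and> Tri (x - 1) = x - 1" for t
  proof -
    from assms(2)[of t] obtain k where "bm t = id_blinfun + Op k" "ktri k = k"
      by (auto simp: group_L_def \<ll>_eq)
    then show ?thesis
      by (intro exI[of _ "Unitize 1 k"]) (simp add: to_op_def Tri_def minus_hs_unitization_def one_hs_unitization_def)
  qed
  then obtain m where m: "\<And>t. bm t = to_op (m t)" "\<And>t. Tri (m t - 1) = m t - 1" by metis
  have "\<exists>x. bp t = to_op x \<and> scalar_part x = 1 \<and> x * star x = 1 \<and> star x * x = 1" for t
  proof -
    from assms(3)[of t] obtain k where "bp t - id_blinfun = Op k"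
      by (auto simp: group_K_def group_G_def \<gg>_eq)
    then have b: "bp t = to_op (Unitize 1 k)" by (simp add: to_op_def algebra_simps)
    from assms(3)[of t] have "to_op (Unitize 1 k * star (Unitize 1 k)) = to_op 1" "to_op (star (Unitize 1 k) * Unitize 1 k) = to_op 1"
      by (simp_all add: group_K_def b adj_to_op to_op_mult)
    then show ?thesis
      by (intro exI[of _ "Unitize 1 k"]) (auto simp: b intro: to_op_cancel)
  qed
  then obtain p where p: "\<And>t. bp t = to_op (p t)" "\<And>t. scalar_part (p t) = 1"
    "\<And>t. p t * star (p t) = 1" "\<And>t. star (p t) * p t = 1" by metis
  have inv_bp: "inv_op (bp t) = to_op (star (p t))" for t
    unfolding p by (intro inv_to_op p)
  define c where "c = - (1/2) *\<^sub>R \<kappa>"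
  have fact: "exp (t *\<^sub>R c) * p t = m t" for t
  proof -
    have "to_op (exp (t *\<^sub>R c)) = to_op (m t * star (p t))"
    proof -
      have "(- (1/2) * t) *\<^sub>R K0 = to_op (t *\<^sub>R c)"
        by (simp add: K0 c_def to_op_linear mult.commute)
      then show ?thesis using assms(4)[of t] by (simp add: exp_to_op to_op_mult inv_bp m(1))
    qed
    moreover have "scalar_part (m t) = 1"
      using arg_cong[OF m(2)[of t], of scalar_part] by simp
    ultimately have "exp (t *\<^sub>R c) = m t * star (p t)"
      by (intro to_op_cancel) (simp_all add: scalar_part_exp c_def \<kappa> p)
    then show ?thesis by (simp add: mult.assoc p)
  qed
  define n where "n t = star (p t) * exp (- (t *\<^sub>R c))" for t
  have mn: "m t * n t = 1" "n t * m t = 1" for t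
    unfolding fact[symmetric] n_def by (intro lower_factor_inverse exp_scaleR_inverse p)+
  have inv_bm: "inv_op (bm t) = to_op (n t)" for t
    unfolding m(1) by (intro inv_to_op mn)
  define Q where "Q t = n t * \<kappa> * m t" for t
  have K: "K t = to_op (Q t)" for t
    by (simp only: K_def Q_def inv_bm K0 to_op_mult) (simp only: m(1))
  have Q0: "scalar_part (Q t) = 0" for t by (simp add: Q_def \<kappa>)
  note flow = factorization_flow_derivative[OF \<kappa> c_def m(2) p(3,4) fact n_def Q_def]
  have 1: "inv_op (bm t) o\<^sub>L K0 o\<^sub>L bm t = inv_op (bp t) o\<^sub>L K0 o\<^sub>L bp t" for t
    unfolding K_def[symmetric] unfolding inv_bp K flow(1) K0 to_op_mult unfolding p(1) ..
  have br: "bracket (to_op a) (to_op b) = to_op (a * b - b * a)" for a b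
    by (simp add: bracket_def to_op_linear to_op_mult)
  have 2: "has_\<gg>_derivative K ((1/2) *\<^sub>R bracket (proj_\<ll> (K t)) (K t)) t" for t
  proof -
    have to_op_Op: "to_op a = Op (kernel_part a)" if "scalar_part a = 0" for a
      using that by (simp add: to_op_def)
    have "(1/2) *\<^sub>R bracket (proj_\<ll> (K t)) (K t)
        = to_op ((1/2) *\<^sub>R (Tri (Q t + star (Q t)) * Q t - Q t * Tri (Q t + star (Q t))))"
      by (simp only: K proj_to_op(1)[OF Q0] br to_op_linear)
    then have D: "(1/2) *\<^sub>R bracket (proj_\<ll> (K t)) (K t)
        = Op (kernel_part ((1/2) *\<^sub>R (Tri (Q t + star (Q t)) * Q t - Q t * Tri (Q t + star (Q t)))))"
      by (subst (asm) to_op_Op) (simp_all add: Q0)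
    show ?thesis
      unfolding has_\<gg>_derivative_def D unfolding K to_op_Op[OF Q0] kernel_Op
      using bounded_linear.has_vector_derivative[OF bounded_linear_kernel_part flow(2)[of t]]
      by (simp add: \<gg>_eq)
  qed
  have 3: "(1/2) *\<^sub>R bracket (proj_\<ll> (K t)) (K t) = (1/2) *\<^sub>R bracket (K t) (proj_\<kk> (K t))" for t
    by (simp add: K proj_to_op[OF Q0] br algebra_simps)
  have 4: "K 0 = K0"
    by (simp add: K Q_def K0 flow(3,4))
  from 1 2 3 4 show ?thesis by blast
qed

end
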